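(* Consider the linear model $Y=X\beta_0+\epsilon$ with $Y,\epsilon\in\mathbb R^n$, $X\in\mathbb R^{n\times p}$, $\beta_0\in\mathbb R^p$ unknown with sparsity $s:=\|\beta_0\|_0$. Assume: (i) the errors $\epsilon_1,\dots,\epsilon_n$ are independent sub-Gaussian random variables with universal constants and $\mathbb E\epsilon_i=0$; (ii) $X$ is random, independent of $\epsilon$, with independent rows $X^{(1)},\dots,X^{(n)}$ that have mean zero and have sub-Gaussian entries with universal constants; and, with $\hat\Sigma:=X^TX/n$ and $\Sigma_0:=\mathbb E\hat\Sigma$, $1/\Lambda_{\min}(\Sigma_0)=\mathcal O(1)$. Suppose that $\|\beta_0\|_2=\mathcal O(1)$ and $s\sqrt{\log p/n}=o(1)$, and let $k\in\{1,2,\dots\}$ be fixed. Consider the Lasso estimator $$\hat\beta:=\arg\min_{\beta\in\mathbb R^p}\ \|Y-X\beta\|_2^2/n+2\lambda\|\beta\|_1$$ with tuning parameter $\lambda\ge c\tau\sqrt{\log p/n}$, where $c>0$ is a sufficiently large universal constant and $\tau>1$ satisfies $\tau^2>2k\log\big((\sqrt s\,\lambda^2)^{-1}\big)/\log p$. Then there exists a universal constant $C_1$ such that $$\big(\mathbb E_{\beta_0}\|\hat\beta-\beta_0\|_1^k\big)^{1/k}\le C_1 s\lambda .$$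
   Context: Asymptotic regime: $n\to\infty$, $p=p_n$ may depend on $n$ (possibly $p\gg n$), and all parameters ($\beta_0,\Sigma_0,\lambda,\tau,s,\dots$) may depend on $n$, the index being suppressed; $\mathcal O(\cdot)$ and $o(\cdot)$ refer to $n\to\infty$. "Universal constant" means a constant not depending on $n$ or $p$. $\|x\|_0$ is the number of non-zero entries of a vector $x$. $\Lambda_{\min}$ denotes the smallest eigenvalue. $\mathbb E_{\beta_0}$ denotes expectation when the true regression vector is $\beta_0$. A random vector $Z\in\mathbb R^m$ has sub-Gaussian entries with constants $K,K_2>0$ if $\mathbb E e^{Z_j^2/K^2}\le K_2$ for $j=1,\dots,m$ (a sub-Gaussian random variable is the case $m=1$). "With universal constants" means that $K,K_2$ can be chosen not depending on $n,p$ (nor on the row/index). *)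

theory Defs
  imports
    "HOL-Probability.Probability"
    "HOL-Library.Landau_Symbols"
    "Jordan_Normal_Form.Char_Poly"
begin

no_notation vec_nth (infixl "$" 90)

definition l0_norm :: "real vec \<Rightarrow> nat" where
  "l0_norm v = card {j. j < dim_vec v \<and> v $ j \<noteq> 0}"

definition l1_norm :: "real vec \<Rightarrow> real" where
  "l1_norm v = (\<Sum>j<dim_vec v. \<bar>v $ j\<bar>)"

definition l2_norm :: "real vec \<Rightarrow> real" where
  "l2_norm v = sqrt (\<Sum>j<dim_vec v. (v $ j)\<^sup>2)"

(* Meant for real symmetric matrices of positive dimension, where the set of
   real eigenvalues is finite and non-empty. *)
definition min_eigenvalue :: "real mat \<Rightarrow> real" where
  "min_eigenvalue A = Min {x. eigenvalue A x}"

(* Integrability is stated explicitly because the Bochner integral of a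
   non-integrable function is 0. *)
definition sub_gaussian :: "'a measure \<Rightarrow> real \<Rightarrow> real \<Rightarrow> ('a \<Rightarrow> real) \<Rightarrow> bool" where
  "sub_gaussian M K K2 Z \<longleftrightarrow>
     Z \<in> borel_measurable M \<and>
     integrable M (\<lambda>\<omega>. exp ((Z \<omega>)\<^sup>2 / K\<^sup>2)) \<and>
     (\<integral>\<omega>. exp ((Z \<omega>)\<^sup>2 / K\<^sup>2) \<partial>M) \<le> K2"

definition gram :: "real mat \<Rightarrow> real mat" where
  "gram A = (1 / real (dim_row A)) \<cdot>\<^sub>m (A\<^sup>T * A)"

definition mean_gram :: "'a measure \<Rightarrow> nat \<Rightarrow> ('a \<Rightarrow> real mat) \<Rightarrow> real mat" where
  "mean_gram M p X = mat p p (\<lambda>(i, j). \<integral>\<omega>. gram (X \<omega>) $$ (i, j) \<partial>M)"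

definition lasso_objective :: "real mat \<Rightarrow> real vec \<Rightarrow> real \<Rightarrow> real vec \<Rightarrow> real" where
  "lasso_objective A y lam b =
     (l2_norm (y - A *\<^sub>v b))\<^sup>2 / real (dim_vec y) + 2 * lam * l1_norm b"

(* The Lasso minimizer need not be unique: an estimator is any measurable selection
   from the set of minimizers. *)
definition lasso_estimator ::
  "'a measure \<Rightarrow> nat \<Rightarrow> ('a \<Rightarrow> real mat) \<Rightarrow> ('a \<Rightarrow> real vec) \<Rightarrow> real \<Rightarrow> ('a \<Rightarrow> real vec) \<Rightarrow> bool"
where
  "lasso_estimator M p X Y lam bhat \<longleftrightarrow>
     (\<forall>j<p. (\<lambda>\<omega>. bhat \<omega> $ j) \<in> borel_measurable M) \<and>
     (\<forall>\<omega>\<in>space M. is_arg_min (lasso_objective (X \<omega>) (Y \<omega>) lam) (\<lambda>b. b \<in> carrier_vec p) (bhat \<omega>))"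

(* design_errors_indep is independence of the sigma-algebras generated by the whole design
   and by the whole error vector: indep_var would require both to have the same value type. *)
locale sub_gaussian_linear_model = prob_space M
  for M :: "'a measure" +
  fixes n p :: nat
    and X :: "'a \<Rightarrow> real mat" and eps Y :: "'a \<Rightarrow> real vec" and beta0 :: "real vec"
    and K K2 :: real
  assumes design_carrier: "\<And>\<omega>. \<omega> \<in> space M \<Longrightarrow> X \<omega> \<in> carrier_mat n p"
    and errors_carrier: "\<And>\<omega>. \<omega> \<in> space M \<Longrightarrow> eps \<omega> \<in> carrier_vec n"
    and beta0_carrier: "beta0 \<in> carrier_vec p"
    and response: "\<And>\<omega>. \<omega> \<in> space M \<Longrightarrow> Y \<omega> = X \<omega> *\<^sub>v beta0 + eps \<omega>"
    and errors_indep: "indep_vars (\<lambda>_. borel) (\<lambda>i \<omega>. eps \<omega> $ i) {..<n}"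
    and errors_sub_gaussian: "\<And>i. i < n \<Longrightarrow> sub_gaussian M K K2 (\<lambda>\<omega>. eps \<omega> $ i)"
    and errors_mean: "\<And>i. i < n \<Longrightarrow> expectation (\<lambda>\<omega>. eps \<omega> $ i) = 0"
    and rows_indep:
      "indep_vars (\<lambda>_. PiM {..<p} (\<lambda>_. borel)) (\<lambda>i \<omega>. \<lambda>j\<in>{..<p}. X \<omega> $$ (i, j)) {..<n}"
    and design_sub_gaussian:
      "\<And>i j. i < n \<Longrightarrow> j < p \<Longrightarrow> sub_gaussian M K K2 (\<lambda>\<omega>. X \<omega> $$ (i, j))"
    and design_mean: "\<And>i j. i < n \<Longrightarrow> j < p \<Longrightarrow> expectation (\<lambda>\<omega>. X \<omega> $$ (i, j)) = 0"
    and design_errors_indep: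
      "indep_set
        (sets (vimage_algebra (space M) (\<lambda>\<omega>. \<lambda>ij\<in>{..<n} \<times> {..<p}. X \<omega> $$ ij)
           (PiM ({..<n} \<times> {..<p}) (\<lambda>_. borel))))
        (sets (vimage_algebra (space M) (\<lambda>\<omega>. \<lambda>i\<in>{..<n}. eps \<omega> $ i)
           (PiM {..<n} (\<lambda>_. borel))))"

end

theory Submission
  imports Defs
begin

text \<open>On the event that all entries of X^T eps / n are below lam / 2 and all entries of the empirical Gram matrix
  are within a / s of their means, the error lies in the cone |d|_1 <= 4 |d_S|_1, where the Gram matrix is
  bounded below by half the smallest eigenvalue of its mean, and the basic inequality gives |d|_1 = O(s lam).
  Off this event, comparing the objective at the estimator and at beta0 still gives |d|_1 <= (sqrt s + 1 / lam) Z
  with all moments of Z bounded. By Bernstein's inequality the event fails with probability at most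
  4 (sqrt s lam^2)^(2 k): for the noise part this is the assumption on tau, and for the Gram part
  it holds for large n because n / s^2 dominates both ln p and ln n. This probability compensates the factor
  sqrt s + 1 / lam as long as lam is bounded, and for lam bounded away from 0 the crude bound alone suffices.\<close>

text \<open>The exponent 2 k, in the assumption on tau as in the probability of the bad event, is
  the price of Cauchy-Schwarz: bounding the k-th moment of the crude bound on an event costs the
  square root of its probability. With r = sqrt s lam^2 and u = sqrt s + 1 / lam, what remains is of
  order (u r)^k, and u r = s lam^2 + sqrt s lam is at most 2 s lam once lam <= 1. The Gram event is
  not tied to tau; its probability is compared with n^(-2k), which lies below r^(2k) because r >=
  lam^2 >= c^2 tau^2 ln p / n >= 1 / n. This is how ln n enters. Two assumptions need translation.
  The smallest eigenvalue is a minimum over a set of eigenvalues and has to become a lower bound for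
  a quadratic form. Independence of design and errors is given for sigma-algebras and has to become
  independence over i of the products X_ij eps_i. The bound is proved for fixed n with explicit
  constants; the asymptotic assumptions serve only large n, and the finitely many remaining n are
  absorbed into C1.\<close>

section \<open>Deterministic inequalities for the Lasso error\<close>

lemma sum_abs_le_sqrt_card:
  fixes f :: "'b \<Rightarrow> real"
  shows "(\<Sum>j\<in>S. \<bar>f j\<bar>) \<le> sqrt (card S) * sqrt (\<Sum>j\<in>S. (f j)\<^sup>2)"
  using L2_set_mult_ineq[of "\<lambda>_. 1" f S] by (simp add: L2_set_def)

text \<open>Entrywise closeness of two matrices costs a squared l1 norm, not an l2 norm. Only on the
  cone, where |d|_1 <= 4 sqrt s |d|_2, can this be absorbed into an eigenvalue bound.\<close>

lemma quadratic_form_perturbation: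
  fixes G H :: "nat \<Rightarrow> nat \<Rightarrow> real"
  assumes "\<And>j l. j < p \<Longrightarrow> l < p \<Longrightarrow> \<bar>G j l - H j l\<bar> \<le> \<eta>"
  shows "(\<Sum>j<p. \<Sum>l<p. H j l * d j * d l) \<le>
    (\<Sum>j<p. \<Sum>l<p. G j l * d j * d l) + \<eta> * (\<Sum>j<p. \<bar>d j\<bar>)\<^sup>2"
proof -
  have "(\<Sum>j<p. \<Sum>l<p. H j l * d j * d l) \<le>
    (\<Sum>j<p. \<Sum>l<p. G j l * d j * d l + \<eta> * (\<bar>d j\<bar> * \<bar>d l\<bar>))"
  proof (intro sum_mono)
    fix j l assume "j \<in> {..<p}" "l \<in> {..<p}"
    then have "\<bar>H j l - G j l\<bar> * \<bar>d j * d l\<bar> \<le> \<eta> * \<bar>d j * d l\<bar>"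
      using assms[of j l] by (intro mult_right_mono) (auto simp: abs_minus_commute)
    moreover have "(H j l - G j l) * (d j * d l) \<le> \<bar>H j l - G j l\<bar> * \<bar>d j * d l\<bar>"
      by (metis abs_ge_self abs_mult)
    ultimately show "H j l * d j * d l \<le> G j l * d j * d l + \<eta> * (\<bar>d j\<bar> * \<bar>d l\<bar>)"
      by (simp add: algebra_simps abs_mult)
  qed
  also have "\<dots> = (\<Sum>j<p. \<Sum>l<p. G j l * d j * d l) + \<eta> * (\<Sum>j<p. \<bar>d j\<bar>)\<^sup>2"
    by (simp only: sum.distrib power2_eq_square sum_product) (simp add: sum_distrib_left)
  finally show ?thesis .
qed

lemma sum_squares_gram:
  fixes x :: "nat \<Rightarrow> nat \<Rightarrow> real"
  shows "(\<Sum>i<n. (\<Sum>j<p. x i j * d j)\<^sup>2) / real n =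
    (\<Sum>j<p. \<Sum>l<p. ((\<Sum>i<n. x i j * x i l) / real n) * d j * d l)"
proof -
  have "(\<Sum>i<n. (\<Sum>j<p. x i j * d j)\<^sup>2) = (\<Sum>i<n. \<Sum>j<p. \<Sum>l<p. x i j * x i l * d j * d l)"
    by (simp add: power2_eq_square sum_product mult_ac)
  also have "\<dots> = (\<Sum>j<p. \<Sum>i<n. \<Sum>l<p. x i j * x i l * d j * d l)"
    by (rule sum.swap)
  also have "\<dots> = (\<Sum>j<p. \<Sum>l<p. \<Sum>i<n. x i j * x i l * d j * d l)"
    by (intro sum.cong refl sum.swap)
  finally show ?thesis
    by (simp add: sum_divide_distrib sum_distrib_right)
qed

text \<open>Discarding the nonnegative residual on the left gives a bound that requires no good
  event; its price is the factor 1 / lam. Here \<open>b\<close> is the true vector, \<open>d\<close>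
  the estimation error and \<open>e\<close> the noise.\<close>

lemma lasso_basic_inequality_crude:
  fixes e d b :: "nat \<Rightarrow> real"
  assumes "lam > 0" "n \<ge> 1"
    and basic: "(\<Sum>i<n. (e i - (\<Sum>j<p. x i j * d j))\<^sup>2) / real n + 2 * lam * (\<Sum>j<p. \<bar>b j + d j\<bar>)
      \<le> (\<Sum>i<n. (e i)\<^sup>2) / real n + 2 * lam * (\<Sum>j<p. \<bar>b j\<bar>)"
  shows "(\<Sum>j<p. \<bar>d j\<bar>) \<le> 2 * (\<Sum>j<p. \<bar>b j\<bar>) + (\<Sum>i<n. (e i)\<^sup>2) / real n / (2 * lam)"
proof -
  have "0 \<le> (\<Sum>i<n. (e i - (\<Sum>j<p. x i j * d j))\<^sup>2) / real n"
    by (simp add: sum_nonneg)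
  then have "2 * lam * (\<Sum>j<p. \<bar>b j + d j\<bar>) \<le> (\<Sum>i<n. (e i)\<^sup>2) / real n + 2 * lam * (\<Sum>j<p. \<bar>b j\<bar>)"
    using basic by linarith
  then have "((\<Sum>j<p. \<bar>b j + d j\<bar>) - (\<Sum>j<p. \<bar>b j\<bar>)) * (2 * lam) \<le> (\<Sum>i<n. (e i)\<^sup>2) / real n"
    by (simp add: algebra_simps)
  then have "(\<Sum>j<p. \<bar>b j + d j\<bar>) - (\<Sum>j<p. \<bar>b j\<bar>) \<le> (\<Sum>i<n. (e i)\<^sup>2) / real n / (2 * lam)"
    using \<open>lam > 0\<close> by (subst pos_le_divide_eq) auto
  moreover have "(\<Sum>j<p. \<bar>d j\<bar>) \<le> (\<Sum>j<p. \<bar>b j + d j\<bar> + \<bar>b j\<bar>)"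
    by (intro sum_mono) linarith
  ultimately show ?thesis
    by (simp add: sum.distrib)
qed

text \<open>Origin of the constants: noise at level lam / 2 makes the cross term at most lam |d|_1,
  half the penalty weight 2 lam, which yields the cone factor 3 and |d|_1 <= 4 |d_S|_1 <= 4 sqrt s
  |d|_2. The Gram error then costs at most 16 eta s |d|_2^2, and 32 eta s <= kap keeps this below
  half of kap |d|_2^2. Finally 24 = 4 * 6, from |d|_2 <= 6 lam sqrt s / kap.\<close>

lemma lasso_oracle_inequality:
  fixes e d b :: "nat \<Rightarrow> real" and x G :: "nat \<Rightarrow> nat \<Rightarrow> real"
  assumes lam: "lam > 0" and n: "n \<ge> 1" and kap: "kap > 0"
    and basic: "(\<Sum>i<n. (e i - (\<Sum>j<p. x i j * d j))\<^sup>2) / real n + 2 * lam * (\<Sum>j<p. \<bar>b j + d j\<bar>)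
      \<le> (\<Sum>i<n. (e i)\<^sup>2) / real n + 2 * lam * (\<Sum>j<p. \<bar>b j\<bar>)"
    and noise: "\<And>j. j < p \<Longrightarrow> \<bar>(\<Sum>i<n. x i j * e i) / real n\<bar> \<le> lam / 2"
    and gram: "\<And>j l. j < p \<Longrightarrow> l < p \<Longrightarrow> \<bar>(\<Sum>i<n. x i j * x i l) / real n - G j l\<bar> \<le> \<eta>"
    and eig: "kap * (\<Sum>j<p. (d j)\<^sup>2) \<le> (\<Sum>j<p. \<Sum>l<p. G j l * d j * d l)"
    and s: "s = card {j. j < p \<and> b j \<noteq> 0}" "32 * \<eta> * real s \<le> kap" "\<eta> \<ge> 0"
  shows "(\<Sum>j<p. \<bar>d j\<bar>) \<le> 24 * real s * lam / kap"
proof -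
  define S where "S = {j. j < p \<and> b j \<noteq> 0}"
  define d1 where "d1 = (\<Sum>j\<in>S. \<bar>d j\<bar>)"
  define d2 where "d2 = (\<Sum>j\<in>{..<p} - S. \<bar>d j\<bar>)"
  define Q where "Q = (\<Sum>i<n. (\<Sum>j<p. x i j * d j)\<^sup>2) / real n"
  define v where "v = sqrt (\<Sum>j<p. (d j)\<^sup>2)"
  have S: "S \<subseteq> {..<p}" "finite S" by (auto simp: S_def)
  have split: "(\<Sum>j<p. f j) = (\<Sum>j\<in>S. f j) + (\<Sum>j\<in>{..<p} - S. f j)" for f :: "nat \<Rightarrow> real"
    using S by (metis add.commute finite_lessThan sum.subset_diff)
  have d: "(\<Sum>j<p. \<bar>d j\<bar>) = d1 + d2" by (simp add: d1_def d2_def split)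
  have "(\<Sum>i<n. e i * (\<Sum>j<p. x i j * d j)) = (\<Sum>j<p. (\<Sum>i<n. x i j * e i) * d j)"
    unfolding sum_distrib_left sum_distrib_right by (subst sum.swap) (simp add: mult_ac)
  then have "(\<Sum>i<n. e i * (\<Sum>j<p. x i j * d j)) / real n = (\<Sum>j<p. (\<Sum>i<n. x i j * e i) / real n * d j)"
    by (simp only: sum_divide_distrib[where A = "{..<p}"] times_divide_eq_left)
  also have "\<dots> \<le> (\<Sum>j<p. lam / 2 * \<bar>d j\<bar>)"
  proof (intro sum_mono)
    fix j assume "j \<in> {..<p}"
    then show "(\<Sum>i<n. x i j * e i) / real n * d j \<le> lam / 2 * \<bar>d j\<bar>"
    proof -
      have "(\<Sum>i<n. x i j * e i) / real n * d j \<le> \<bar>(\<Sum>i<n. x i j * e i) / real n\<bar> * \<bar>d j\<bar>"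
        by (metis abs_ge_self abs_mult)
      also have "\<dots> \<le> lam / 2 * \<bar>d j\<bar>"
        using noise[of j] \<open>j \<in> {..<p}\<close> by (intro mult_right_mono) auto
      finally show ?thesis .
    qed
  qed
  also have "\<dots> = lam / 2 * (d1 + d2)" by (simp only: d[symmetric] sum_distrib_left)
  finally have cross: "2 * ((\<Sum>i<n. e i * (\<Sum>j<p. x i j * d j)) / real n) \<le> lam * (d1 + d2)"
    by (simp add: mult.commute)
  have expand: "(\<Sum>i<n. (e i - (\<Sum>j<p. x i j * d j))\<^sup>2) / real n =
      (\<Sum>i<n. (e i)\<^sup>2) / real n - 2 * ((\<Sum>i<n. e i * (\<Sum>j<p. x i j * d j)) / real n) + Q"
  proof -
    have "(\<Sum>i<n. (e i - (\<Sum>j<p. x i j * d j))\<^sup>2) =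
      (\<Sum>i<n. (e i)\<^sup>2 - 2 * (e i * (\<Sum>j<p. x i j * d j)) + (\<Sum>j<p. x i j * d j)\<^sup>2)"
      by (simp add: power2_diff algebra_simps)
    also have "\<dots> = (\<Sum>i<n. (e i)\<^sup>2) - 2 * (\<Sum>i<n. e i * (\<Sum>j<p. x i j * d j)) + (\<Sum>i<n. (\<Sum>j<p. x i j * d j)\<^sup>2)"
      by (simp only: sum.distrib sum_subtractf sum_distrib_left)
    finally show ?thesis by (simp add: Q_def diff_divide_distrib add_divide_distrib)
  qed
  have "(\<Sum>j\<in>S. \<bar>b j\<bar>) \<le> (\<Sum>j\<in>S. \<bar>b j + d j\<bar> + \<bar>d j\<bar>)"
    by (intro sum_mono) linarith
  moreover have "(\<Sum>j\<in>{..<p} - S. \<bar>b j + d j\<bar>) = d2"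
    unfolding d2_def by (intro sum.cong) (auto simp: S_def)
  moreover have "(\<Sum>j\<in>{..<p} - S. \<bar>b j\<bar>) = 0"
    by (intro sum.neutral) (auto simp: S_def)
  ultimately have b: "(\<Sum>j<p. \<bar>b j\<bar>) - (\<Sum>j<p. \<bar>b j + d j\<bar>) \<le> d1 - d2"
    by (simp add: split d1_def sum.distrib)
  have "2 * lam * ((\<Sum>j<p. \<bar>b j\<bar>) - (\<Sum>j<p. \<bar>b j + d j\<bar>)) \<le> 2 * lam * (d1 - d2)"
    using b lam by (intro mult_left_mono) auto
  \<comment> \<open>The penalty contributes 2 lam (d1 - d2) and the noise lam (d1 + d2);
    \<open>d2\<close> keeps the coefficient -lam and moves to the left.\<close>
  then have main: "Q + lam * d2 \<le> 3 * lam * d1"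
    using basic cross unfolding expand by (simp add: algebra_simps)
  have Q0: "Q \<ge> 0" by (simp add: Q_def sum_nonneg)
  then have "lam * d2 \<le> lam * (3 * d1)" using main by simp
  then have cone: "d2 \<le> 3 * d1" using lam by simp
  have d2: "d2 \<ge> 0" "d1 \<ge> 0" by (simp_all add: d1_def d2_def sum_nonneg)
  have "d1 \<le> sqrt s * sqrt (\<Sum>j\<in>S. (d j)\<^sup>2)"
    unfolding d1_def using sum_abs_le_sqrt_card[of d S] by (simp add: s(1) S_def)
  also have "\<dots> \<le> sqrt s * v"
    unfolding v_def using S by (intro mult_left_mono real_sqrt_le_mono sum_mono2) auto
  finally have d1v: "d1 \<le> sqrt s * v" .
  have v0: "v \<ge> 0" by (simp add: v_def sum_nonneg)
  have v2: "v\<^sup>2 = (\<Sum>j<p. (d j)\<^sup>2)" by (simp add: v_def sum_nonneg)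
  have "(d1 + d2)\<^sup>2 \<le> (4 * (sqrt s * v))\<^sup>2"
    using d1v cone d2 by (intro power_mono) auto
  also have "\<dots> = 16 * s * v\<^sup>2" by (simp add: power_mult_distrib)
  finally have "\<eta> * (d1 + d2)\<^sup>2 \<le> \<eta> * (16 * s * v\<^sup>2)"
    using s(3) by (rule mult_left_mono)
  also have "\<dots> = (32 * \<eta> * s) * v\<^sup>2 / 2" by simp
  also have "\<dots> \<le> kap * v\<^sup>2 / 2" 
    using s(2) by (intro divide_right_mono mult_right_mono) auto
  finally have pert: "\<eta> * (d1 + d2)\<^sup>2 \<le> kap * v\<^sup>2 / 2" .
  have "kap * v\<^sup>2 \<le> Q + \<eta> * (d1 + d2)\<^sup>2"
    using eig quadratic_form_perturbation[of p "\<lambda>j l. (\<Sum>i<n. x i j * x i l) / real n" G \<eta> d, OF gram]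
    unfolding d[symmetric] Q_def sum_squares_gram v2 by linarith
  then have "kap * v\<^sup>2 / 2 \<le> Q" using pert by linarith
  also have "Q \<le> 3 * lam * d1" using main lam d2 mult_nonneg_nonneg[of lam d2] by linarith
  also have "\<dots> \<le> 3 * lam * (sqrt s * v)" using d1v lam by simp
  finally have "v * (kap * v) \<le> v * (6 * lam * sqrt s)" by (simp add: power2_eq_square algebra_simps)
  then have "kap * v \<le> 6 * lam * sqrt s"
    using v0 lam by (cases "v = 0") auto
  then have "v \<le> 6 * lam * sqrt s / kap" using kap by (simp add: field_simps)
  then have "sqrt s * v \<le> sqrt s * (6 * lam * sqrt s / kap)"
    by (intro mult_left_mono) auto
  also have "\<dots> = 6 * lam * s / kap" by simp
  finally have "4 * d1 \<le> 4 * (6 * lam * s / kap)" using d1v by linarith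
  also have "\<dots> = 24 * real s * lam / kap" by simp
  finally show ?thesis using cone d by linarith
qed

section \<open>The smallest eigenvalue as a bound for the quadratic form\<close>

text \<open>The dimension \<open>p\<close> is a term and not a type, so R^p is modelled by functions
  on the naturals that vanish from \<open>p\<close> on. The sphere is then closed inside the cube
  [-1, 1]^nat, which is compact by Tychonoff.\<close>

lemma compact_unit_sphere_fun:
  "compact {f :: nat \<Rightarrow> real. (\<forall>i\<ge>p. f i = 0) \<and> (\<Sum>i<p. (f i)\<^sup>2) = 1}" (is "compact ?K")
proof -
  have "compactin (product_topology (\<lambda>_::nat. euclidean :: real topology) UNIV) (PiE UNIV (\<lambda>_. {-1..1}))"
    by (subst compactin_PiE) auto
  then have cpt: "compact (PiE (UNIV :: nat set) (\<lambda>_. {-1..1::real}))"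
    by (simp add: euclidean_product_topology)
  have cont: "continuous_on UNIV (\<lambda>f :: nat \<Rightarrow> real. f i)" for i
    by simp
  have "closed {f :: nat \<Rightarrow> real. f i = 0}" for i
    by (intro closed_Collect_eq cont continuous_on_const)
  then have 1: "closed {f :: nat \<Rightarrow> real. \<forall>i\<ge>p. f i = 0}"
    unfolding Collect_all_eq by (intro closed_INT ballI) (auto simp: Collect_imp_eq)
  have "closed {f :: nat \<Rightarrow> real. (\<Sum>i<p. (f i)\<^sup>2) = 1}"
    by (intro closed_Collect_eq continuous_on_sum continuous_on_power continuous_on_const cont)
  with 1 have "closed ?K" by (rule closed_Collect_conj)
  then have "compact (PiE UNIV (\<lambda>_. {-1..1}) \<inter> ?K)"
    using cpt by (intro compact_Int_closed)
  moreover have "?K \<subseteq> PiE UNIV (\<lambda>_. {-1..1})"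
  proof safe
    fix f :: "nat \<Rightarrow> real" and i
    assume f: "\<forall>i\<ge>p. f i = 0" "(\<Sum>i<p. (f i)\<^sup>2) = 1"
    show "f i \<in> {-1..1}"
    proof (cases "i < p")
      case True
      then have "(f i)\<^sup>2 \<le> (\<Sum>i<p. (f i)\<^sup>2)"
        by (intro member_le_sum) auto
      then have "\<bar>f i\<bar> \<le> 1" using f(2) abs_square_le_1 by auto
      then show ?thesis by auto
    qed (use f in auto)
  qed auto
  ultimately show ?thesis by (simp only: inf.absorb2)
qed

text \<open>The minimizer of the Rayleigh quotient on the unit sphere is an eigenvector: the shifted form is
  positive semidefinite and vanishes there, so its first variation vanishes as well.\<close>

lemma min_eigenvalue_le_quadratic_form:
  fixes A :: "real mat"
  assumes A: "A \<in> carrier_mat p p" and p: "p \<ge> 1"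
    and sym: "\<And>i j. i < p \<Longrightarrow> j < p \<Longrightarrow> A $$ (i, j) = A $$ (j, i)"
  shows "min_eigenvalue A * (\<Sum>j<p. (d j)\<^sup>2) \<le> (\<Sum>j<p. \<Sum>l<p. A $$ (j, l) * d j * d l)"
proof -
  define Q where "Q f g = (\<Sum>j<p. \<Sum>l<p. A $$ (j, l) * f j * g l)" for f g :: "nat \<Rightarrow> real"
  define N where "N f = (\<Sum>i<p. (f i)\<^sup>2)" for f :: "nat \<Rightarrow> real"
  define S where "S = {f :: nat \<Rightarrow> real. (\<forall>i\<ge>p. f i = 0) \<and> N f = 1}"
  have "N (\<lambda>i. if i = 0 then 1 else 0) = (\<Sum>i<p. if i = 0 then 1 else 0)"
    unfolding N_def by (intro sum.cong) auto
  also have "\<dots> = 1" using p by simp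
  finally have "(\<lambda>i. if i = 0 then 1 else 0) \<in> S" using p by (auto simp: S_def)
  then have "S \<noteq> {}" by blast
  moreover have "compact S" unfolding S_def N_def by (rule compact_unit_sphere_fun)
  moreover have "continuous_on S (\<lambda>f. Q f f)"
    unfolding Q_def
    by (intro continuous_on_sum continuous_on_mult continuous_on_const
      continuous_on_subset[OF continuous_on_product_coordinates] subset_UNIV)
  ultimately obtain v where v: "v \<in> S" "\<And>f. f \<in> S \<Longrightarrow> Q v v \<le> Q f f"
    using continuous_attains_inf[of S "\<lambda>f. Q f f"] by blast
  define \<mu> where "\<mu> = Q v v"
  have Nv: "N v = 1" using v by (simp add: S_def)
  \<comment> \<open>Both sides are homogeneous of degree 2 and depend only on the coordinates below
    \<open>p\<close>, so minimality on the sphere extends to all \<open>f\<close> by scaling and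
    truncation.\<close>
  have low: "\<mu> * N f \<le> Q f f" for f
  proof (cases "N f = 0")
    case True
    then have "\<forall>i<p. f i = 0" by (auto simp: N_def sum_nonneg_eq_0_iff)
    then show ?thesis using True by (simp add: Q_def)
  next
    case False
    have N0: "N f > 0" using False by (simp add: N_def sum_nonneg less_le)
    define c where "c = 1 / sqrt (N f)"
    define g where "g i = (if i < p then c * f i else 0)" for i
    have c2: "c * c = 1 / N f" using N0 by (simp add: c_def real_sqrt_mult[symmetric])
    have "N g = (\<Sum>i<p. c * c * (f i)\<^sup>2)" unfolding N_def
      by (intro sum.cong) (auto simp: g_def power2_eq_square)
    then have "N g = c * c * N f" by (simp only: sum_distrib_left N_def)
    then have "N g = 1" using N0 by (simp add: c2)
    then have "g \<in> S" by (auto simp: S_def g_def)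
    then have "\<mu> \<le> Q g g" using v by (simp add: \<mu>_def)
    also have "Q g g = (\<Sum>j<p. \<Sum>l<p. c * c * (A $$ (j, l) * f j * f l))"
      unfolding Q_def by (intro sum.cong) (auto simp: g_def)
    also have "\<dots> = c * c * Q f f" unfolding Q_def by (simp add: sum_distrib_left)
    finally show ?thesis using N0 by (simp add: c2 field_simps)
  qed
  \<comment> \<open>The residual A v - mu v, used also as the direction of variation; the aim is to
    show that it vanishes.\<close>
  define w where "w j = (\<Sum>l<p. A $$ (j, l) * v l) - \<mu> * v j" for j
  \<comment> \<open>This is \<open>low\<close> at v + t w. The constant terms cancel since Q v v =
    mu and N v = 1, and by symmetry the linear coefficient is 2 <w, A v - mu v> = 2 N w.\<close>
  have var: "0 \<le> 2 * t * N w + t\<^sup>2 * (Q w w - \<mu> * N w)" for t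
  proof -
    let ?f = "\<lambda>j. v j + t * w j"
    have Qe: "Q ?f ?f = Q v v + t * Q v w + t * Q w v + t\<^sup>2 * Q w w"
    proof -
      have "Q ?f ?f = (\<Sum>j<p. \<Sum>l<p. A $$ (j, l) * v j * v l + t * (A $$ (j, l) * v j * w l)
        + t * (A $$ (j, l) * w j * v l) + t\<^sup>2 * (A $$ (j, l) * w j * w l))"
        unfolding Q_def by (intro sum.cong refl) (simp add: algebra_simps power2_eq_square)
      then show ?thesis by (simp add: Q_def sum.distrib sum_distrib_left)
    qed
    have "Q v w = (\<Sum>l<p. \<Sum>j<p. A $$ (j, l) * v j * w l)" unfolding Q_def by (rule sum.swap)
    also have "\<dots> = Q w v" unfolding Q_def
      by (intro sum.cong refl) (use sym in auto)
    finally have Qs: "Q v w = Q w v" .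
    have eq: "\<mu> * v j + w j = (\<Sum>l<p. A $$ (j, l) * v l)" for j by (simp add: w_def)
    have "(\<Sum>j<p. w j * v j) * \<mu> + N w = (\<Sum>j<p. w j * (\<mu> * v j + w j))"
      by (simp add: N_def sum_distrib_left sum_distrib_right sum.distrib algebra_simps power2_eq_square)
    also have "\<dots> = Q w v" unfolding Q_def
      by (intro sum.cong refl) (simp only: eq sum_distrib_left mult_ac)
    finally have Qwv: "Q w v = (\<Sum>j<p. w j * v j) * \<mu> + N w" by simp
    have Ne: "N ?f = N v + 2 * t * (\<Sum>j<p. w j * v j) + t\<^sup>2 * N w"
    proof -
      have "N ?f = (\<Sum>j<p. (v j)\<^sup>2 + 2 * t * (w j * v j) + t\<^sup>2 * (w j)\<^sup>2)"
        unfolding N_def by (intro sum.cong refl) (simp add: algebra_simps power2_eq_square)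
      then show ?thesis by (simp add: N_def sum.distrib sum_distrib_left)
    qed
    have "\<mu> * N ?f \<le> Q ?f ?f" by (rule low)
    then show ?thesis unfolding Ne Qe Qs Qwv Nv \<mu>_def[symmetric] by (simp add: algebra_simps)
  qed
  have "N w = 0"
  proof (rule ccontr)
    assume "N w \<noteq> 0"
    then have Nw: "N w > 0" by (simp add: N_def sum_nonneg less_le)
    define R where "R = \<bar>Q w w - \<mu> * N w\<bar> + 1"
    have R: "R > 0" "Q w w - \<mu> * N w < R" by (auto simp: R_def)
    \<comment> \<open>\<open>R\<close> is positive and exceeds the quadratic coefficient, so this
      \<open>t\<close> makes the expression smaller than -(N w)^2 / R.\<close>
    define t where "t = - (N w / R)"
    have "t\<^sup>2 * (Q w w - \<mu> * N w) \<le> t\<^sup>2 * R" using R by (intro mult_left_mono) auto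
    also have "2 * t * N w + t\<^sup>2 * R = - ((N w)\<^sup>2 / R)"
      using R by (simp add: t_def power2_eq_square field_simps)
    also have "\<dots> < 0" using Nw R by simp
    finally have "2 * t * N w + t\<^sup>2 * (Q w w - \<mu> * N w) < 0" by simp
    with var[of t] show False by linarith
  qed
  then have w0: "w j = 0" if "j < p" for j
    using that by (auto simp: N_def sum_nonneg_eq_0_iff)
  define u where "u = vec p v"
  have "u \<noteq> 0\<^sub>v p"
  proof
    assume "u = 0\<^sub>v p"
    then have "v i = 0" if "i < p" for i using that by (metis u_def index_vec index_zero_vec(1))
    then have "N v = 0" by (simp add: N_def)
    with Nv show False by simp
  qed
  moreover have "A *\<^sub>v u = \<mu> \<cdot>\<^sub>v u"
  proof (rule eq_vecI)
    fix i assume "i < dim_vec (\<mu> \<cdot>\<^sub>v u)"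
    then have i: "i < p" by (simp add: u_def)
    then have "(A *\<^sub>v u) $ i = (\<Sum>l<p. A $$ (i, l) * v l)"
      using A by (simp add: u_def scalar_prod_def lessThan_atLeast0)
    also have "\<dots> = \<mu> * v i" using w0[OF i] by (simp add: w_def)
    finally show "(A *\<^sub>v u) $ i = (\<mu> \<cdot>\<^sub>v u) $ i" using i by (simp add: u_def)
  qed (use A in \<open>simp add: u_def\<close>)
  ultimately have "eigenvalue A \<mu>"
    using A unfolding eigenvalue_def eigenvector_def by (auto intro!: exI[of _ u] simp: u_def)
  \<comment> \<open>\<open>Min\<close> is meaningful only on a finite set; the eigenvalues are the
    roots of the nonzero characteristic polynomial.\<close>
  moreover have "finite {x. eigenvalue A x}"
  proof -
    have "char_poly A \<noteq> 0" using degree_monic_char_poly[OF A] by auto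
    then show ?thesis using poly_roots_finite[of "char_poly A"]
      by (simp add: eigenvalue_root_char_poly[OF A])
  qed
  ultimately have "min_eigenvalue A \<le> \<mu>" unfolding min_eigenvalue_def by (intro Min_le) auto
  then have "min_eigenvalue A * N d \<le> \<mu> * N d"
    by (intro mult_right_mono) (auto simp: N_def sum_nonneg)
  then show ?thesis using low[of d] by (simp add: N_def Q_def)
qed

section \<open>Exponential moments and Bernstein's inequality\<close>

text \<open>A single term of the exponential series. It converts exponential moments into polynomial
  moments of every order and is the source of the factorials in the constants.\<close>

lemma power_le_fact_exp:
  assumes "x \<ge> (0::real)"
  shows "x ^ m \<le> fact m * exp x"
proof -
  have "x ^ m / fact m \<le> (\<Sum>i<Suc m. x ^ i / fact i)"
    using assms by (intro member_le_sum[of m]) auto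
  also have "\<dots> \<le> exp x"
  proof -
    obtain t where "exp x = (\<Sum>i<Suc m. x ^ i / fact i) + exp t / fact (Suc m) * x ^ Suc m"
      using Maclaurin_exp_le[of x "Suc m"] by blast
    moreover have "exp t / fact (Suc m) * x ^ Suc m \<ge> 0" using assms by (intro mult_nonneg_nonneg) auto
    ultimately show ?thesis by linarith
  qed
  finally show ?thesis by (simp add: field_simps)
qed

lemma exp_le_quadratic_remainder:
  fixes x :: real
  shows "exp x \<le> 1 + x + x\<^sup>2 / 2 * exp \<bar>x\<bar>"
proof -
  obtain t where t: "\<bar>t\<bar> \<le> \<bar>x\<bar>" "exp x = (\<Sum>i<2. x ^ i / fact i) + exp t / fact 2 * x\<^sup>2"
    using Maclaurin_exp_le[of x 2] by blast
  have "exp t \<le> exp \<bar>x\<bar>" using t(1) by auto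
  then have "exp t * x\<^sup>2 \<le> exp \<bar>x\<bar> * x\<^sup>2" by (intro mult_right_mono) auto
  then show ?thesis using t(2) by (simp add: numeral_2_eq_2 field_simps)
qed

context prob_space
begin

text \<open>The factor 4 comes from the bounds exp x <= 1 + x + x^2/2 exp |x| and u^2 <= 8 exp (u/2).\<close>

lemma sub_exponential_mgf:
  fixes B L t :: real
  assumes [measurable]: "random_variable borel W"
    and int: "integrable M (\<lambda>\<omega>. exp (\<bar>W \<omega>\<bar> / B))" and bound: "expectation (\<lambda>\<omega>. exp (\<bar>W \<omega>\<bar> / B)) \<le> L"
    and B: "B > 0" and t: "\<bar>t\<bar> \<le> 1 / (2 * B)"
  shows "integrable M W"
    and "integrable M (\<lambda>\<omega>. exp (t * (W \<omega> - expectation W)))"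
    and "expectation (\<lambda>\<omega>. exp (t * (W \<omega> - expectation W))) \<le> exp (4 * t\<^sup>2 * B\<^sup>2 * L)"
proof -
  have W_le: "\<bar>W \<omega>\<bar> \<le> B * exp (\<bar>W \<omega>\<bar> / B)" for \<omega>
    using power_le_fact_exp[of "\<bar>W \<omega>\<bar> / B" 1] B by (simp add: field_simps)
  show intW: "integrable M W"
    by (rule Bochner_Integration.integrable_bound[of M "\<lambda>\<omega>. B * exp (\<bar>W \<omega>\<bar> / B)"]) (use int W_le B in auto)
  \<comment> \<open>The range of \<open>t\<close> uses up only half of the exponent |W| / B; the
    other half absorbs the square, so nothing beyond the assumed exp (|W| / B) is
    integrated.\<close>
  have pw: "exp (t * W \<omega>) \<le> 1 + t * W \<omega> + 4 * t\<^sup>2 * B\<^sup>2 * exp (\<bar>W \<omega>\<bar> / B)" for \<omega>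
  proof -
    define u where "u = \<bar>W \<omega>\<bar> / B"
    have u: "u \<ge> 0" using B by (simp add: u_def)
    have "(u / 2)\<^sup>2 \<le> 2 * exp (u / 2)" using power_le_fact_exp[of "u / 2" 2] u by simp
    then have u2: "u\<^sup>2 \<le> 8 * exp (u / 2)" by (simp add: power_divide)
    have tw: "\<bar>t * W \<omega>\<bar> \<le> u / 2"
    proof -
      have "\<bar>t\<bar> * \<bar>W \<omega>\<bar> \<le> 1 / (2 * B) * \<bar>W \<omega>\<bar>" using t by (intro mult_right_mono) auto
      then show ?thesis by (simp add: abs_mult u_def)
    qed
    have sq: "(t * W \<omega>)\<^sup>2 = t\<^sup>2 * B\<^sup>2 * u\<^sup>2" using B by (simp add: u_def power_mult_distrib power_divide)
    have "(t * W \<omega>)\<^sup>2 / 2 * exp \<bar>t * W \<omega>\<bar> \<le> t\<^sup>2 * B\<^sup>2 * u\<^sup>2 / 2 * exp (u / 2)"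
      unfolding sq using tw by (intro mult_left_mono) auto
    also have "\<dots> \<le> t\<^sup>2 * B\<^sup>2 * (8 * exp (u / 2)) / 2 * exp (u / 2)"
      using u2 by (intro mult_right_mono divide_right_mono mult_left_mono) auto
    also have "\<dots> = 4 * t\<^sup>2 * B\<^sup>2 * (exp (u / 2) * exp (u / 2))" by (simp add: field_simps)
    also have "exp (u / 2) * exp (u / 2) = exp u" by (simp add: exp_add[symmetric])
    finally show ?thesis using exp_le_quadratic_remainder[of "t * W \<omega>"] by (simp add: u_def)
  qed
  have inte: "integrable M (\<lambda>\<omega>. exp (t * W \<omega>))"
  proof (rule Bochner_Integration.integrable_bound)
    show "integrable M (\<lambda>\<omega>. 1 + t * W \<omega> + 4 * t\<^sup>2 * B\<^sup>2 * exp (\<bar>W \<omega>\<bar> / B))"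
      using int intW by auto
    show "AE \<omega> in M. norm (exp (t * W \<omega>)) \<le> norm (1 + t * W \<omega> + 4 * t\<^sup>2 * B\<^sup>2 * exp (\<bar>W \<omega>\<bar> / B))"
      using pw by (intro AE_I2) (smt (verit) exp_gt_zero real_norm_def)
  qed auto
  have split: "exp (t * (W \<omega> - expectation W)) = exp (- t * expectation W) * exp (t * W \<omega>)" for \<omega>
    by (simp add: exp_add[symmetric] algebra_simps)
  show "integrable M (\<lambda>\<omega>. exp (t * (W \<omega> - expectation W)))"
    unfolding split using inte by auto
  have "expectation (\<lambda>\<omega>. exp (t * W \<omega>)) \<le> expectation (\<lambda>\<omega>. 1 + t * W \<omega> + 4 * t\<^sup>2 * B\<^sup>2 * exp (\<bar>W \<omega>\<bar> / B))"
    using inte int intW pw by (intro integral_mono) auto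
  also have "\<dots> = 1 + t * expectation W + 4 * t\<^sup>2 * B\<^sup>2 * expectation (\<lambda>\<omega>. exp (\<bar>W \<omega>\<bar> / B))"
    using int intW by (simp add: prob_space)
  also have "\<dots> \<le> 1 + (t * expectation W + 4 * t\<^sup>2 * B\<^sup>2 * L)"
    using bound by (simp add: mult_left_mono)
  also have "\<dots> \<le> exp (t * expectation W + 4 * t\<^sup>2 * B\<^sup>2 * L)"
    by (rule exp_ge_add_one_self)
  \<comment> \<open>Centring comes last: the uncentred bound carries the mean in its exponent, where
    this factor cancels it. No exponential moment of the centred variable has to be
    estimated.\<close>
  finally have "exp (- t * expectation W) * expectation (\<lambda>\<omega>. exp (t * W \<omega>)) \<le>
      exp (- t * expectation W) * exp (t * expectation W + 4 * t\<^sup>2 * B\<^sup>2 * L)"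
    by (intro mult_left_mono) auto
  also have "\<dots> = exp (4 * t\<^sup>2 * B\<^sup>2 * L)" by (simp add: exp_add[symmetric])
  finally show "expectation (\<lambda>\<omega>. exp (t * (W \<omega> - expectation W))) \<le> exp (4 * t\<^sup>2 * B\<^sup>2 * L)"
    unfolding split by simp
qed

lemma sub_exponential_mgf_sum:
  fixes B L t :: real
  assumes I: "finite I" and indep: "indep_vars (\<lambda>_. borel) W I"
    and int: "\<And>i. i \<in> I \<Longrightarrow> integrable M (\<lambda>\<omega>. exp (\<bar>W i \<omega>\<bar> / B))"
    and bound: "\<And>i. i \<in> I \<Longrightarrow> expectation (\<lambda>\<omega>. exp (\<bar>W i \<omega>\<bar> / B)) \<le> L"
    and B: "B > 0" and t: "\<bar>t\<bar> \<le> 1 / (2 * B)"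
  shows "integrable M (\<lambda>\<omega>. exp (t * (\<Sum>i\<in>I. W i \<omega> - expectation (W i))))"
    and "expectation (\<lambda>\<omega>. exp (t * (\<Sum>i\<in>I. W i \<omega> - expectation (W i)))) \<le> exp (card I * (4 * t\<^sup>2 * B\<^sup>2 * L))"
proof -
  have [measurable]: "random_variable borel (W i)" if "i \<in> I" for i
    using indep that by (auto simp: indep_vars_def)
  note mgf = sub_exponential_mgf[OF _ int bound B t]
  have prod: "exp (t * (\<Sum>i\<in>I. W i \<omega> - expectation (W i))) = (\<Prod>i\<in>I. exp (t * (W i \<omega> - expectation (W i))))" for \<omega>
    using I by (simp add: sum_distrib_left exp_sum)
  have ind: "indep_vars (\<lambda>_. borel) (\<lambda>i \<omega>. exp (t * (W i \<omega> - expectation (W i)))) I"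
    by (rule indep_vars_compose2[OF indep]) auto
  show "integrable M (\<lambda>\<omega>. exp (t * (\<Sum>i\<in>I. W i \<omega> - expectation (W i))))"
    unfolding prod using mgf(2) by (intro indep_vars_integrable I ind) auto
  have "expectation (\<lambda>\<omega>. exp (t * (\<Sum>i\<in>I. W i \<omega> - expectation (W i)))) =
     (\<Prod>i\<in>I. expectation (\<lambda>\<omega>. exp (t * (W i \<omega> - expectation (W i)))))"
    unfolding prod using mgf(2) by (intro indep_vars_lebesgue_integral I ind) auto
  also have "\<dots> \<le> (\<Prod>i\<in>I. exp (4 * t\<^sup>2 * B\<^sup>2 * L))"
    using mgf(3) by (intro prod_mono) auto
  also have "\<dots> = exp (card I * (4 * t\<^sup>2 * B\<^sup>2 * L))" by (simp add: exp_of_nat_mult)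
  finally show "expectation (\<lambda>\<omega>. exp (t * (\<Sum>i\<in>I. W i \<omega> - expectation (W i)))) \<le> exp (card I * (4 * t\<^sup>2 * B\<^sup>2 * L))" .
qed

text \<open>Chernoff's method with t = a / (8 B^2 L), the minimizer of 4 t^2 B^2 L - t a. The
  restriction a <= 4 B L says exactly that this t satisfies t <= 1 / (2 B), so only the Gaussian
  range of deviations is covered.\<close>

lemma bernstein_inequality:
  fixes B L a :: real
  assumes n: "n \<ge> (1::nat)" and indep: "indep_vars (\<lambda>_. borel) W {..<n}"
    and int: "\<And>i. i < n \<Longrightarrow> integrable M (\<lambda>\<omega>. exp (\<bar>W i \<omega>\<bar> / B))"
    and bound: "\<And>i. i < n \<Longrightarrow> expectation (\<lambda>\<omega>. exp (\<bar>W i \<omega>\<bar> / B)) \<le> L"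
    and B: "B > 0" and L: "L > 0" and a: "0 \<le> a" "a \<le> 4 * B * L"
  shows "prob {\<omega> \<in> space M. a \<le> \<bar>(\<Sum>i<n. W i \<omega>) / n - (\<Sum>i<n. expectation (W i)) / n\<bar>}
    \<le> 2 * exp (- (n * a\<^sup>2 / (16 * B\<^sup>2 * L)))"
proof -
  define S where "S \<omega> = (\<Sum>i<n. W i \<omega> - expectation (W i))" for \<omega>
  define t where "t = a / (8 * B\<^sup>2 * L)"
  have [measurable]: "random_variable borel (W i)" if "i < n" for i
    using indep that by (auto simp: indep_vars_def)
  have [measurable]: "S \<in> borel_measurable M" unfolding S_def by measurable
  have t0: "t \<ge> 0" using a B L by (simp add: t_def)
  have "t \<le> 4 * B * L / (8 * B\<^sup>2 * L)" unfolding t_def using a B L by (intro divide_right_mono) auto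
  also have "\<dots> = 1 / (2 * B)" using B L by (simp add: power2_eq_square)
  finally have t1: "t \<le> 1 / (2 * B)" .
  \<comment> \<open>The sign \<open>\<sigma>\<close> treats the upper and the lower tail at
    once.\<close>
  have tail: "prob {\<omega> \<in> space M. n * a \<le> \<sigma> * S \<omega>} \<le> exp (- (n * a\<^sup>2 / (16 * B\<^sup>2 * L)))" if \<sigma>: "\<bar>\<sigma>\<bar> = 1" for \<sigma>
  proof -
    have \<sigma>2: "\<sigma> * \<sigma> = 1" using \<sigma> by (metis abs_mult_self_eq mult_1)
    have st: "\<bar>\<sigma> * t\<bar> \<le> 1 / (2 * B)" using t0 t1 \<sigma> by (simp add: abs_mult)
    note mgf = sub_exponential_mgf_sum[OF finite_lessThan indep int bound B st, simplified, folded S_def]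
    have "prob {\<omega> \<in> space M. n * a \<le> \<sigma> * S \<omega>} \<le> prob {\<omega> \<in> space M. exp (t * (n * a)) \<le> exp (\<sigma> * t * S \<omega>)}"
    proof (rule finite_measure_mono)
      show "{\<omega> \<in> space M. n * a \<le> \<sigma> * S \<omega>} \<subseteq> {\<omega> \<in> space M. exp (t * (n * a)) \<le> exp (\<sigma> * t * S \<omega>)}"
        using mult_left_mono[OF _ t0] by (fastforce simp: mult_ac)
    qed measurable
    also have "\<dots> \<le> expectation (\<lambda>\<omega>. exp (\<sigma> * t * S \<omega>)) / exp (t * (n * a))"
      using mgf(1) by (intro integral_Markov_inequality_measure[where A = "space M"]) auto
    also have "\<dots> \<le> exp (n * (4 * (\<sigma> * t)\<^sup>2 * B\<^sup>2 * L)) / exp (t * (n * a))"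
      using mgf(2) by (intro divide_right_mono) auto
    also have "\<dots> = exp (- (n * a\<^sup>2 / (16 * B\<^sup>2 * L)))"
      using B L by (simp add: exp_diff[symmetric] t_def power_mult_distrib \<sigma>2 power2_eq_square field_simps)
    finally show ?thesis .
  qed
  have "prob {\<omega> \<in> space M. a \<le> \<bar>(\<Sum>i<n. W i \<omega>) / n - (\<Sum>i<n. expectation (W i)) / n\<bar>}
     \<le> prob ({\<omega> \<in> space M. n * a \<le> 1 * S \<omega>} \<union> {\<omega> \<in> space M. n * a \<le> (-1) * S \<omega>})"
  proof (rule finite_measure_mono)
    have "(\<Sum>i<n. W i \<omega>) / n - (\<Sum>i<n. expectation (W i)) / n = S \<omega> / n" for \<omega>
      by (simp add: S_def sum_subtractf diff_divide_distrib)
    then show "{\<omega> \<in> space M. a \<le> \<bar>(\<Sum>i<n. W i \<omega>) / n - (\<Sum>i<n. expectation (W i)) / n\<bar>}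
      \<subseteq> {\<omega> \<in> space M. n * a \<le> 1 * S \<omega>} \<union> {\<omega> \<in> space M. n * a \<le> (-1) * S \<omega>}"
      using n by (auto simp: field_simps abs_if split: if_splits)
  qed measurable
  also have "\<dots> \<le> prob {\<omega> \<in> space M. n * a \<le> 1 * S \<omega>} + prob {\<omega> \<in> space M. n * a \<le> (-1) * S \<omega>}"
    by (rule measure_Un_le) measurable
  also have "\<dots> \<le> 2 * exp (- (n * a\<^sup>2 / (16 * B\<^sup>2 * L)))"
    using tail[of 1] tail[of "-1"] by simp
  finally show ?thesis .
qed

end

section \<open>Sub-Gaussian variables and merging of independent families\<close>

lemma sub_gaussian_integrable:
  assumes "prob_space M" "K > 0" "sub_gaussian M K K2 Z"
  shows "integrable M Z"
proof -
  interpret prob_space M by fact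
  have [measurable]: "Z \<in> borel_measurable M" and int: "integrable M (\<lambda>\<omega>. exp ((Z \<omega>)\<^sup>2 / K\<^sup>2))"
    using assms(3) by (auto simp: sub_gaussian_def)
  show ?thesis
  proof (rule Bochner_Integration.integrable_bound)
    show "integrable M (\<lambda>\<omega>. K * exp ((Z \<omega>)\<^sup>2 / K\<^sup>2))" using int by simp
    show "AE \<omega> in M. norm (Z \<omega>) \<le> norm (K * exp ((Z \<omega>)\<^sup>2 / K\<^sup>2))"
    proof (rule AE_I2)
      fix \<omega>
      have "\<bar>Z \<omega> / K\<bar> \<le> 1 + (Z \<omega> / K)\<^sup>2"
        using zero_le_power2[of "\<bar>Z \<omega> / K\<bar> - 1"] zero_le_power2[of "Z \<omega> / K"]
        unfolding power2_diff power2_abs one_power2 by linarith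
      also have "\<dots> \<le> exp ((Z \<omega> / K)\<^sup>2)" by (rule exp_ge_add_one_self)
      finally show "norm (Z \<omega>) \<le> norm (K * exp ((Z \<omega>)\<^sup>2 / K\<^sup>2))"
        using assms(2) by (simp add: power_divide field_simps)
    qed
  qed measurable
qed

text \<open>Products of sub-Gaussian variables are sub-exponential by the inequality 2|uv| <= u^2 + v^2 and the
  arithmetic-geometric mean inequality for the resulting exponentials.\<close>

lemma sub_gaussian_mult:
  assumes "K > 0" "sub_gaussian M K K2 U" "sub_gaussian M K K2 V"
  shows "integrable M (\<lambda>\<omega>. exp (\<bar>U \<omega> * V \<omega>\<bar> / K\<^sup>2))"
    and "(\<integral>\<omega>. exp (\<bar>U \<omega> * V \<omega>\<bar> / K\<^sup>2) \<partial>M) \<le> K2"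
proof -
  have [measurable]: "U \<in> borel_measurable M" "V \<in> borel_measurable M"
    and int: "integrable M (\<lambda>\<omega>. exp ((U \<omega>)\<^sup>2 / K\<^sup>2))" "integrable M (\<lambda>\<omega>. exp ((V \<omega>)\<^sup>2 / K\<^sup>2))"
    and le: "(\<integral>\<omega>. exp ((U \<omega>)\<^sup>2 / K\<^sup>2) \<partial>M) \<le> K2" "(\<integral>\<omega>. exp ((V \<omega>)\<^sup>2 / K\<^sup>2) \<partial>M) \<le> K2"
    using assms by (auto simp: sub_gaussian_def)
  have pw: "exp (\<bar>U \<omega> * V \<omega>\<bar> / K\<^sup>2) \<le> (exp ((U \<omega>)\<^sup>2 / K\<^sup>2) + exp ((V \<omega>)\<^sup>2 / K\<^sup>2)) / 2" for \<omega>
  proof -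
    define a where "a = exp ((U \<omega>)\<^sup>2 / K\<^sup>2 / 2)"
    define b where "b = exp ((V \<omega>)\<^sup>2 / K\<^sup>2 / 2)"
    have "2 * \<bar>U \<omega> * V \<omega>\<bar> \<le> (U \<omega>)\<^sup>2 + (V \<omega>)\<^sup>2"
      using zero_le_power2[of "\<bar>U \<omega>\<bar> - \<bar>V \<omega>\<bar>"] by (simp add: power2_diff abs_mult)
    then have "\<bar>U \<omega> * V \<omega>\<bar> / K\<^sup>2 \<le> (((U \<omega>)\<^sup>2 + (V \<omega>)\<^sup>2) / 2) / K\<^sup>2"
      by (intro divide_right_mono) auto
    also have "\<dots> = (U \<omega>)\<^sup>2 / K\<^sup>2 / 2 + (V \<omega>)\<^sup>2 / K\<^sup>2 / 2" by (simp add: add_divide_distrib)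
    finally have "exp (\<bar>U \<omega> * V \<omega>\<bar> / K\<^sup>2) \<le> a * b"
      by (simp add: a_def b_def exp_add[symmetric])
    also have "\<dots> \<le> (a\<^sup>2 + b\<^sup>2) / 2"
      using zero_le_power2[of "a - b"] by (simp add: power2_diff)
    also have "a\<^sup>2 = exp ((U \<omega>)\<^sup>2 / K\<^sup>2)" unfolding a_def by (subst exp_double[symmetric]) simp
    also have "b\<^sup>2 = exp ((V \<omega>)\<^sup>2 / K\<^sup>2)" unfolding b_def by (subst exp_double[symmetric]) simp
    finally show ?thesis .
  qed
  show int': "integrable M (\<lambda>\<omega>. exp (\<bar>U \<omega> * V \<omega>\<bar> / K\<^sup>2))"
  proof (rule Bochner_Integration.integrable_bound)
    show "integrable M (\<lambda>\<omega>. (exp ((U \<omega>)\<^sup>2 / K\<^sup>2) + exp ((V \<omega>)\<^sup>2 / K\<^sup>2)) / 2)" using int by auto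
  qed (use pw in \<open>auto intro!: AE_I2 order_trans[OF _ abs_ge_self]\<close>)
  have "(\<integral>\<omega>. exp (\<bar>U \<omega> * V \<omega>\<bar> / K\<^sup>2) \<partial>M) \<le> (\<integral>\<omega>. (exp ((U \<omega>)\<^sup>2 / K\<^sup>2) + exp ((V \<omega>)\<^sup>2 / K\<^sup>2)) / 2 \<partial>M)"
    using int int' pw by (intro integral_mono) auto
  also have "\<dots> \<le> K2" using int le by simp
  finally show "(\<integral>\<omega>. exp (\<bar>U \<omega> * V \<omega>\<bar> / K\<^sup>2) \<partial>M) \<le> K2" .
qed

text \<open>A finite intersection splits into an event of \<open>MA\<close> and one of
  \<open>MB\<close>. Its probability factors first across the two sigma-algebras and then within
  each family. The sum type keeps the indices apart, since both families will be indexed by the same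
  set.\<close>

lemma (in prob_space) indep_vars_case_sum:
  fixes U :: "'i \<Rightarrow> 'a \<Rightarrow> real" and V :: "'j \<Rightarrow> 'a \<Rightarrow> real"
  assumes U: "indep_vars (\<lambda>_. borel) U I" and V: "indep_vars (\<lambda>_. borel) V J"
    and ind: "indep_set (sets MA) (sets MB)"
    and space: "space MA = space M" "space MB = space M"
    and UA: "\<And>i. i \<in> I \<Longrightarrow> U i \<in> borel_measurable MA" and VB: "\<And>j. j \<in> J \<Longrightarrow> V j \<in> borel_measurable MB"
  shows "indep_vars (\<lambda>_. borel) (case_sum U V) (I <+> J)"
  unfolding indep_vars_def2
proof (intro conjI ballI indep_setsI)
  fix k assume k: "k \<in> I <+> J"
  then show rv: "random_variable borel (case_sum U V k)"
    using U V by (auto simp: indep_vars_def)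
  show "{case_sum U V k -` A \<inter> space M |A. A \<in> sets borel} \<subseteq> events"
    using measurable_sets[OF rv] by auto
next
  fix A H assume H: "H \<noteq> {}" "H \<subseteq> I <+> J" "finite H"
    and A: "\<forall>k\<in>H. A k \<in> {case_sum U V k -` S \<inter> space M |S. S \<in> sets borel}"
  define H1 where "H1 = {i. Inl i \<in> H}"
  define H2 where "H2 = {j. Inr j \<in> H}"
  have H12: "H1 \<subseteq> I" "H2 \<subseteq> J" "finite H1" "finite H2" "H = Inl ` H1 \<union> Inr ` H2"
    using H by (auto simp: H1_def H2_def intro!: finite_vimageI[unfolded vimage_def])
  have A1: "\<exists>S\<in>sets borel. A (Inl i) = U i -` S \<inter> space M" if "i \<in> H1" for i
    using A that by (force simp: H1_def)
  have A2: "\<exists>S\<in>sets borel. A (Inr i) = V i -` S \<inter> space M" if "i \<in> H2" for i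
    using A that by (force simp: H2_def)
  \<comment> \<open>Comprehensions over the space rather than intersections: when \<open>H1\<close>
    or \<open>H2\<close> is empty, the set is the whole space, matching the empty product 1.\<close>
  let ?A1 = "{x \<in> space M. \<forall>i\<in>H1. x \<in> A (Inl i)}"
  let ?A2 = "{x \<in> space M. \<forall>i\<in>H2. x \<in> A (Inr i)}"
  have "?A1 \<in> sets MA"
    unfolding space(1)[symmetric]
  proof (rule sets.sets_Collect_finite_All)
    fix i assume i: "i \<in> H1"
    then obtain S where S: "S \<in> sets borel" "A (Inl i) = U i -` S \<inter> space M" using A1 by blast
    have "U i -` S \<inter> space MA \<in> sets MA"
      using UA[of i] S(1) i H12(1) by (intro measurable_sets[of _ _ borel]) auto
    then show "{x \<in> space MA. x \<in> A (Inl i)} \<in> sets MA"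
      using S(2) space by (simp add: Int_def conj_commute)
  qed (use H12 in auto)
  moreover have "?A2 \<in> sets MB"
    unfolding space(2)[symmetric]
  proof (rule sets.sets_Collect_finite_All)
    fix i assume i: "i \<in> H2"
    then obtain S where S: "S \<in> sets borel" "A (Inr i) = V i -` S \<inter> space M" using A2 by blast
    have "V i -` S \<inter> space MB \<in> sets MB"
      using VB[of i] S(1) i H12(2) by (intro measurable_sets[of _ _ borel]) auto
    then show "{x \<in> space MB. x \<in> A (Inr i)} \<in> sets MB"
      using S(2) space by (simp add: Int_def conj_commute)
  qed (use H12 in auto)
  ultimately have prob12: "prob (?A1 \<inter> ?A2) = prob ?A1 * prob ?A2"
    by (rule indep_setD[OF ind])
  have p1: "prob ?A1 = (\<Prod>i\<in>H1. prob (A (Inl i)))"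
  proof (cases "H1 = {}")
    case False
    then have "?A1 = (\<Inter>i\<in>H1. A (Inl i))" using A1 by blast
    also have "prob \<dots> = (\<Prod>i\<in>H1. prob (A (Inl i)))"
    proof (rule indep_setsD[OF conjunct2[OF U[unfolded indep_vars_def2]] H12(1) False H12(3)])
      show "\<forall>i\<in>H1. A (Inl i) \<in> {U i -` S \<inter> space M |S. S \<in> sets borel}"
        using A1 by blast
    qed
    finally show ?thesis .
  qed (simp add: prob_space)
  have p2: "prob ?A2 = (\<Prod>i\<in>H2. prob (A (Inr i)))"
  proof (cases "H2 = {}")
    case False
    then have "?A2 = (\<Inter>i\<in>H2. A (Inr i))" using A2 by blast
    also have "prob \<dots> = (\<Prod>i\<in>H2. prob (A (Inr i)))"
    proof (rule indep_setsD[OF conjunct2[OF V[unfolded indep_vars_def2]] H12(2) False H12(4)])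
      show "\<forall>i\<in>H2. A (Inr i) \<in> {V i -` S \<inter> space M |S. S \<in> sets borel}"
        using A2 by blast
    qed
    finally show ?thesis .
  qed (simp add: prob_space)
  have "(\<Inter>k\<in>H. A k) = ?A1 \<inter> ?A2"
  proof -
    obtain k where "k \<in> H" using H by blast
    then have "A k \<subseteq> space M" using A by blast
    then have "(\<Inter>k\<in>H. A k) \<subseteq> space M" using \<open>k \<in> H\<close> by blast
    then show ?thesis unfolding H12(5) by blast
  qed
  then have "prob (\<Inter>k\<in>H. A k) = (\<Prod>i\<in>H1. prob (A (Inl i))) * (\<Prod>i\<in>H2. prob (A (Inr i)))"
    using prob12 p1 p2 by simp
  also have "\<dots> = (\<Prod>k\<in>Inl ` H1. prob (A k)) * (\<Prod>k\<in>Inr ` H2. prob (A k))"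
    by (simp add: prod.reindex)
  also have "\<dots> = (\<Prod>k\<in>H. prob (A k))"
    unfolding H12(5) using H12 by (intro prod.union_disjoint[symmetric]) auto
  finally show "prob (\<Inter>k\<in>H. A k) = (\<Prod>k\<in>H. prob (A k))" .
qed

section \<open>Concentration of the noise term, the Gram matrix and the errors\<close>

context sub_gaussian_linear_model
begin

lemma measurable_design [measurable]:
  "i < n \<Longrightarrow> j < p \<Longrightarrow> (\<lambda>\<omega>. X \<omega> $$ (i, j)) \<in> borel_measurable M"
  using design_sub_gaussian by (auto simp: sub_gaussian_def)

lemma measurable_errors [measurable]: "i < n \<Longrightarrow> (\<lambda>\<omega>. eps \<omega> $ i) \<in> borel_measurable M"
  using errors_sub_gaussian by (auto simp: sub_gaussian_def)

text \<open>Each product is a function of row i alone, so independence of the rows carries over; the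
  two factors themselves may be dependent.\<close>

lemma indep_design_columns:
  assumes j: "j < p" and l: "l < p"
  shows "indep_vars (\<lambda>_. borel) (\<lambda>i \<omega>. X \<omega> $$ (i, j) * X \<omega> $$ (i, l)) {..<n}"
proof -
  have "indep_vars (\<lambda>_. borel) (\<lambda>i \<omega>. (\<lambda>r. r j * r l) (\<lambda>j\<in>{..<p}. X \<omega> $$ (i, j))) {..<n}"
    using j l by (intro indep_vars_compose2[OF rows_indep]) auto
  then show ?thesis using j l by simp
qed

text \<open>The entries and the errors are coordinates of the two maps that generate the
  sigma-algebras in \<open>design_errors_indep\<close>, hence measurable with respect to
  them.\<close>

lemma indep_column_errors:
  assumes j: "j < p"
  shows "indep_vars (\<lambda>_. borel) (case_sum (\<lambda>i \<omega>. X \<omega> $$ (i, j)) (\<lambda>i \<omega>. eps \<omega> $ i)) ({..<n} <+> {..<n})"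
proof (rule indep_vars_case_sum[OF _ errors_indep design_errors_indep])
  have "indep_vars (\<lambda>_. borel) (\<lambda>i \<omega>. (\<lambda>r. r j) (\<lambda>j\<in>{..<p}. X \<omega> $$ (i, j))) {..<n}"
    using j by (intro indep_vars_compose2[OF rows_indep]) auto
  then show "indep_vars (\<lambda>_. borel) (\<lambda>i \<omega>. X \<omega> $$ (i, j)) {..<n}"
    using j by simp
next
  fix i assume i: "i \<in> {..<n}"
  let ?F = "\<lambda>\<omega>. \<lambda>ij\<in>{..<n} \<times> {..<p}. X \<omega> $$ ij"
  have "?F \<in> measurable (vimage_algebra (space M) ?F (PiM ({..<n} \<times> {..<p}) (\<lambda>_. borel))) (PiM ({..<n} \<times> {..<p}) (\<lambda>_. borel))"
    by (intro measurable_vimage_algebra1) (auto simp: space_PiM)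
  then have "(\<lambda>\<omega>. ?F \<omega> (i, j)) \<in> borel_measurable (vimage_algebra (space M) ?F (PiM ({..<n} \<times> {..<p}) (\<lambda>_. borel)))"
    by (rule measurable_compose[OF _ measurable_component_singleton]) (use i j in auto)
  then show "(\<lambda>\<omega>. X \<omega> $$ (i, j)) \<in> borel_measurable (vimage_algebra (space M) ?F (PiM ({..<n} \<times> {..<p}) (\<lambda>_. borel)))"
    using i j by simp
next
  fix i assume i: "i \<in> {..<n}"
  let ?F = "\<lambda>\<omega>. \<lambda>i\<in>{..<n}. eps \<omega> $ i"
  have "?F \<in> measurable (vimage_algebra (space M) ?F (PiM {..<n} (\<lambda>_. borel))) (PiM {..<n} (\<lambda>_. borel))"
    by (intro measurable_vimage_algebra1) (auto simp: space_PiM)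
  then have "(\<lambda>\<omega>. ?F \<omega> i) \<in> borel_measurable (vimage_algebra (space M) ?F (PiM {..<n} (\<lambda>_. borel)))"
    by (rule measurable_compose[OF _ measurable_component_singleton]) (use i in auto)
  then show "(\<lambda>\<omega>. eps \<omega> $ i) \<in> borel_measurable (vimage_algebra (space M) ?F (PiM {..<n} (\<lambda>_. borel)))"
    using i by simp
qed auto

text \<open>The joint family is grouped into the disjoint pairs {Inl i, Inr i}; functions of
  disjoint groups remain independent.\<close>

lemma indep_column_times_errors:
  assumes j: "j < p"
  shows "indep_vars (\<lambda>_. borel) (\<lambda>i \<omega>. X \<omega> $$ (i, j) * eps \<omega> $ i) {..<n}"
proof -
  let ?Z = "case_sum (\<lambda>i \<omega>. X \<omega> $$ (i, j)) (\<lambda>i \<omega>. eps \<omega> $ i)"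
  have "indep_vars (\<lambda>i. PiM {Inl i, Inr i} (\<lambda>_. borel)) (\<lambda>i \<omega>. restrict (\<lambda>k. ?Z k \<omega>) {Inl i, Inr i}) {..<n}"
    by (rule indep_vars_restrict[OF indep_column_errors[OF j]]) (auto simp: disjoint_family_on_def)
  then have "indep_vars (\<lambda>_. borel) (\<lambda>i \<omega>. (\<lambda>f. f (Inl i) * f (Inr i)) (restrict (\<lambda>k. ?Z k \<omega>) {Inl i, Inr i})) {..<n}"
    by (rule indep_vars_compose2) auto
  then show ?thesis by simp
qed

lemma expectation_design_times_errors:
  assumes K: "K > 0" and i: "i < n" and j: "j < p"
  shows "expectation (\<lambda>\<omega>. X \<omega> $$ (i, j) * eps \<omega> $ i) = 0"
proof -
  let ?Z = "case_sum (\<lambda>i \<omega>. X \<omega> $$ (i, j)) (\<lambda>i \<omega>. eps \<omega> $ i)"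
  have "indep_vars (\<lambda>_. borel) ?Z {Inl i, Inr i}"
    by (rule indep_vars_subset[OF indep_column_errors[OF j]]) (use i in auto)
  moreover have "integrable M (?Z k)" if "k \<in> {Inl i, Inr i}" for k
    using that sub_gaussian_integrable[OF prob_space_axioms K design_sub_gaussian[OF i j]]
      sub_gaussian_integrable[OF prob_space_axioms K errors_sub_gaussian[OF i]] by auto
  ultimately have "expectation (\<lambda>\<omega>. \<Prod>k\<in>{Inl i, Inr i}. ?Z k \<omega>) = (\<Prod>k\<in>{Inl i, Inr i}. expectation (?Z k))"
    by (intro indep_vars_lebesgue_integral) auto
  then show ?thesis using errors_mean[OF i] by simp
qed

text \<open>Bernstein's inequality with B = K^2 and L = K2, followed by a union bound over the
  \<open>p\<close> coordinates; hence K^4 in the exponent.\<close>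

lemma noise_tail:
  fixes a :: real
  assumes K: "K > 0" "K2 > 0" and n: "n \<ge> 1" and a: "0 \<le> a" "a \<le> 4 * K\<^sup>2 * K2"
  shows "prob {\<omega> \<in> space M. \<exists>j<p. a \<le> \<bar>(\<Sum>i<n. X \<omega> $$ (i, j) * eps \<omega> $ i) / n\<bar>}
    \<le> p * (2 * exp (- (n * a\<^sup>2 / (16 * K ^ 4 * K2))))"
proof -
  let ?A = "\<lambda>j. {\<omega> \<in> space M. a \<le> \<bar>(\<Sum>i<n. X \<omega> $$ (i, j) * eps \<omega> $ i) / n\<bar>}"
  have tail: "prob (?A j) \<le> 2 * exp (- (n * a\<^sup>2 / (16 * K ^ 4 * K2)))" if j: "j < p" for j
    using bernstein_inequality[OF n indep_column_times_errors[OF j], of "K\<^sup>2" K2 a]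
      sub_gaussian_mult[OF K(1) design_sub_gaussian[OF _ j] errors_sub_gaussian] K a
    by (simp add: expectation_design_times_errors[OF K(1) _ j] power_mult[symmetric])
  have "{\<omega> \<in> space M. \<exists>j<p. a \<le> \<bar>(\<Sum>i<n. X \<omega> $$ (i, j) * eps \<omega> $ i) / n\<bar>} = (\<Union>j\<in>{..<p}. ?A j)" by auto
  also have "prob \<dots> \<le> (\<Sum>j<p. prob (?A j))"
    by (intro finite_measure_subadditive_finite) auto
  also have "\<dots> \<le> (\<Sum>j<p. 2 * exp (- (n * a\<^sup>2 / (16 * K ^ 4 * K2))))"
    using tail by (intro sum_mono) auto
  finally show ?thesis by simp
qed

lemma gram_entry:
  assumes "\<omega> \<in> space M" "j < p" "l < p"
  shows "gram (X \<omega>) $$ (j, l) = (\<Sum>i<n. X \<omega> $$ (i, j) * X \<omega> $$ (i, l)) / n"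
  using design_carrier[OF assms(1)] assms(2,3)
  by (simp add: gram_def scalar_prod_def lessThan_atLeast0)

lemma mean_gram_entry:
  assumes K: "K > 0" and j: "j < p" and l: "l < p"
  shows "mean_gram M p X $$ (j, l) = (\<Sum>i<n. expectation (\<lambda>\<omega>. X \<omega> $$ (i, j) * X \<omega> $$ (i, l))) / n"
proof -
  have "integrable M (\<lambda>\<omega>. X \<omega> $$ (i, j) * X \<omega> $$ (i, l))" if i: "i < n" for i
  proof (rule sub_exponential_mgf(1)[where B = "K\<^sup>2" and L = K2 and t = 0])
    show "random_variable borel (\<lambda>\<omega>. X \<omega> $$ (i, j) * X \<omega> $$ (i, l))"
      by (intro borel_measurable_times measurable_design i j l)
  qed (use K in \<open>auto intro: sub_gaussian_mult[OF K design_sub_gaussian[OF i j] design_sub_gaussian[OF i l]]\<close>)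
  moreover have "mean_gram M p X $$ (j, l) = expectation (\<lambda>\<omega>. (\<Sum>i<n. X \<omega> $$ (i, j) * X \<omega> $$ (i, l)) / n)"
    using j l by (simp add: mean_gram_def gram_entry cong: Bochner_Integration.integral_cong)
  ultimately show ?thesis by simp
qed

lemma gram_tail:
  fixes a :: real
  assumes K: "K > 0" "K2 > 0" and n: "n \<ge> 1" and a: "0 \<le> a" "a \<le> 4 * K\<^sup>2 * K2"
  shows "prob {\<omega> \<in> space M. \<exists>j<p. \<exists>l<p.
      a \<le> \<bar>(\<Sum>i<n. X \<omega> $$ (i, j) * X \<omega> $$ (i, l)) / n - mean_gram M p X $$ (j, l)\<bar>}
    \<le> (real p)\<^sup>2 * (2 * exp (- (n * a\<^sup>2 / (16 * K ^ 4 * K2))))"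
proof -
  let ?A = "\<lambda>jl. {\<omega> \<in> space M. a \<le> \<bar>(\<Sum>i<n. X \<omega> $$ (i, fst jl) * X \<omega> $$ (i, snd jl)) / n - mean_gram M p X $$ jl\<bar>}"
  have tail: "prob (?A (j, l)) \<le> 2 * exp (- (n * a\<^sup>2 / (16 * K ^ 4 * K2)))" if j: "j < p" and l: "l < p" for j l
    using bernstein_inequality[OF n indep_design_columns[OF j l], of "K\<^sup>2" K2 a]
      sub_gaussian_mult[OF K(1) design_sub_gaussian[OF _ j] design_sub_gaussian[OF _ l]] K a
    by (simp add: mean_gram_entry[OF K(1) j l] power_mult[symmetric])
  have "{\<omega> \<in> space M. \<exists>j<p. \<exists>l<p.
      a \<le> \<bar>(\<Sum>i<n. X \<omega> $$ (i, j) * X \<omega> $$ (i, l)) / n - mean_gram M p X $$ (j, l)\<bar>}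
      = (\<Union>jl\<in>{..<p} \<times> {..<p}. ?A jl)" by auto blast
  also have "prob \<dots> \<le> (\<Sum>jl\<in>{..<p} \<times> {..<p}. prob (?A jl))"
    by (intro finite_measure_subadditive_finite) auto
  also have "\<dots> \<le> (\<Sum>jl\<in>{..<p} \<times> {..<p}. 2 * exp (- (n * a\<^sup>2 / (16 * K ^ 4 * K2))))"
    using tail by (intro sum_mono) auto
  finally show ?thesis by (simp add: power2_eq_square)
qed

text \<open>By convexity of exp, the exponential of the average is at most the average of the
  exponentials, so the mean square inherits the bound of a single error, uniformly in n.\<close>

lemma exp_mean_squared_errors:
  assumes n: "n \<ge> 1"
  shows "integrable M (\<lambda>\<omega>. exp ((\<Sum>i<n. (eps \<omega> $ i)\<^sup>2) / n / K\<^sup>2))"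
    and "expectation (\<lambda>\<omega>. exp ((\<Sum>i<n. (eps \<omega> $ i)\<^sup>2) / n / K\<^sup>2)) \<le> K2"
proof -
  have int: "integrable M (\<lambda>\<omega>. exp ((eps \<omega> $ i)\<^sup>2 / K\<^sup>2))"
    and le: "expectation (\<lambda>\<omega>. exp ((eps \<omega> $ i)\<^sup>2 / K\<^sup>2)) \<le> K2" if "i < n" for i
    using errors_sub_gaussian[OF that] by (auto simp: sub_gaussian_def)
  have pw: "exp ((\<Sum>i<n. (eps \<omega> $ i)\<^sup>2) / n / K\<^sup>2) \<le> (\<Sum>i<n. 1 / n * exp ((eps \<omega> $ i)\<^sup>2 / K\<^sup>2))" for \<omega>
  proof -
    have "exp (\<Sum>i<n. (1 / n) *\<^sub>R ((eps \<omega> $ i)\<^sup>2 / K\<^sup>2)) \<le> (\<Sum>i<n. 1 / n * exp ((eps \<omega> $ i)\<^sup>2 / K\<^sup>2))"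
      using n by (intro convex_on_sum[OF _ _ exp_convex]) (auto simp: lessThan_empty_iff)
    then show ?thesis by (simp add: sum_divide_distrib mult_ac)
  qed
  show int': "integrable M (\<lambda>\<omega>. exp ((\<Sum>i<n. (eps \<omega> $ i)\<^sup>2) / n / K\<^sup>2))"
  proof (rule Bochner_Integration.integrable_bound)
    show "integrable M (\<lambda>\<omega>. \<Sum>i<n. 1 / n * exp ((eps \<omega> $ i)\<^sup>2 / K\<^sup>2))" using int by auto
  qed (use pw in \<open>auto intro!: AE_I2 order_trans[OF _ abs_ge_self]\<close>)
  have "expectation (\<lambda>\<omega>. exp ((\<Sum>i<n. (eps \<omega> $ i)\<^sup>2) / n / K\<^sup>2)) \<le> expectation (\<lambda>\<omega>. \<Sum>i<n. 1 / n * exp ((eps \<omega> $ i)\<^sup>2 / K\<^sup>2))"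
    using int int' pw by (intro integral_mono) auto
  also have "\<dots> = (\<Sum>i<n. 1 / n * expectation (\<lambda>\<omega>. exp ((eps \<omega> $ i)\<^sup>2 / K\<^sup>2)))"
    using int by simp
  also have "\<dots> \<le> (\<Sum>i<n. 1 / n * K2)" using le by (intro sum_mono mult_left_mono) auto
  also have "\<dots> = K2" using n by simp
  finally show "expectation (\<lambda>\<omega>. exp ((\<Sum>i<n. (eps \<omega> $ i)\<^sup>2) / n / K\<^sup>2)) \<le> K2" .
qed

end

section \<open>Moments of the estimation error for fixed n\<close>

text \<open>Expands (x y - 1)^2 >= 0. Applied pointwise with a suitable x, it takes the place of
  Cauchy-Schwarz under the integral.\<close>

lemma weighted_am_gm:
  fixes x y :: real
  assumes "x > 0"
  shows "y \<le> (x * y\<^sup>2 + 1 / x) / 2"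
proof -
  have "0 \<le> (x * y - 1)\<^sup>2" by simp
  also have "\<dots> = x * (x * y\<^sup>2 + 1 / x - 2 * y)"
    using assms by (simp add: power2_eq_square algebra_simps)
  finally show ?thesis using assms by (simp add: zero_le_mult_iff)
qed

context sub_gaussian_linear_model
begin

text \<open>Brings minimality against \<open>beta0\<close> into the coordinate form assumed by the
  two deterministic Lasso lemmas.\<close>

lemma lasso_estimator_basic_inequality:
  assumes est: "lasso_estimator M p X Y lam bhat" and \<omega>: "\<omega> \<in> space M"
  shows "(\<Sum>i<n. (eps \<omega> $ i - (\<Sum>j<p. X \<omega> $$ (i, j) * (bhat \<omega> $ j - beta0 $ j)))\<^sup>2) / real n
      + 2 * lam * (\<Sum>j<p. \<bar>beta0 $ j + (bhat \<omega> $ j - beta0 $ j)\<bar>)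
    \<le> (\<Sum>i<n. (eps \<omega> $ i)\<^sup>2) / real n + 2 * lam * (\<Sum>j<p. \<bar>beta0 $ j\<bar>)"
proof -
  have Xc: "X \<omega> \<in> carrier_mat n p" and ec: "eps \<omega> \<in> carrier_vec n"
    using design_carrier errors_carrier \<omega> by auto
  have obj: "lasso_objective (X \<omega>) (Y \<omega>) lam b =
    (\<Sum>i<n. (eps \<omega> $ i - (\<Sum>j<p. X \<omega> $$ (i, j) * (b $ j - beta0 $ j)))\<^sup>2) / real n
      + 2 * lam * (\<Sum>j<p. \<bar>b $ j\<bar>)" if b: "b \<in> carrier_vec p" for b
  proof -
    have dim: "dim_vec (Y \<omega>) = n" using response[OF \<omega>] ec Xc by auto
    have "(Y \<omega> - X \<omega> *\<^sub>v b) $ i = eps \<omega> $ i - (\<Sum>j<p. X \<omega> $$ (i, j) * (b $ j - beta0 $ j))" if "i < n" for i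
      using that Xc ec b beta0_carrier
      by (simp add: response[OF \<omega>] scalar_prod_def lessThan_atLeast0 sum_subtractf algebra_simps)
    then have "(l2_norm (Y \<omega> - X \<omega> *\<^sub>v b))\<^sup>2 = (\<Sum>i<n. (eps \<omega> $ i - (\<Sum>j<p. X \<omega> $$ (i, j) * (b $ j - beta0 $ j)))\<^sup>2)"
      using Xc by (simp add: l2_norm_def sum_nonneg)
    then show ?thesis using b dim by (simp add: lasso_objective_def l1_norm_def)
  qed
  have "is_arg_min (lasso_objective (X \<omega>) (Y \<omega>) lam) (\<lambda>b. b \<in> carrier_vec p) (bhat \<omega>)"
    using est \<omega> by (auto simp: lasso_estimator_def)
  then have "bhat \<omega> \<in> carrier_vec p" "lasso_objective (X \<omega>) (Y \<omega>) lam (bhat \<omega>) \<le> lasso_objective (X \<omega>) (Y \<omega>) lam beta0"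
    using beta0_carrier by (auto simp: is_arg_min_def not_less)
  then show ?thesis using beta0_carrier by (simp add: obj)
qed

lemma l1_norm_error: "l1_norm (b - beta0) = (\<Sum>j<p. \<bar>b $ j - beta0 $ j\<bar>)"
  using beta0_carrier by (simp add: l1_norm_def)

lemma measurable_l1_norm_error:
  assumes "lasso_estimator M p X Y lam bhat"
  shows "(\<lambda>\<omega>. l1_norm (bhat \<omega> - beta0)) \<in> borel_measurable M"
proof -
  have [measurable]: "(\<lambda>\<omega>. bhat \<omega> $ j) \<in> borel_measurable M" if "j < p" for j
    using assms that by (auto simp: lasso_estimator_def)
  show ?thesis unfolding l1_norm_error by measurable
qed

text \<open>Cauchy-Schwarz on the support gives |beta0|_1 <= sqrt s A. The product form separates a
  deterministic factor, which may grow with n, from a random one whose moments are bounded uniformly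
  in n.\<close>

lemma l1_norm_error_crude:
  assumes est: "lasso_estimator M p X Y lam bhat" and \<omega>: "\<omega> \<in> space M"
    and n: "n \<ge> 1" and lam: "lam > 0" and A: "l2_norm beta0 \<le> A"
  shows "l1_norm (bhat \<omega> - beta0) \<le>
    (sqrt (l0_norm beta0) + 1 / lam) * (2 * A + (\<Sum>i<n. (eps \<omega> $ i)\<^sup>2) / n / 2)"
proof -
  define V where "V = (\<Sum>i<n. (eps \<omega> $ i)\<^sup>2) / n"
  have V: "V \<ge> 0" by (simp add: V_def sum_nonneg)
  have "0 \<le> l2_norm beta0" by (simp add: l2_norm_def sum_nonneg)
  then have A0: "0 \<le> A" using A by linarith
  let ?S = "{j. j < p \<and> beta0 $ j \<noteq> 0}"
  have "(\<Sum>j<p. \<bar>beta0 $ j\<bar>) = (\<Sum>j\<in>?S. \<bar>beta0 $ j\<bar>)"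
    by (intro sum.mono_neutral_right) auto
  also have "\<dots> \<le> sqrt (card ?S) * sqrt (\<Sum>j\<in>?S. (beta0 $ j)\<^sup>2)"
    by (rule sum_abs_le_sqrt_card)
  also have "\<dots> \<le> sqrt (card ?S) * sqrt (\<Sum>j<p. (beta0 $ j)\<^sup>2)"
    by (intro mult_left_mono real_sqrt_le_mono sum_mono2) auto
  also have "\<dots> = sqrt (l0_norm beta0) * l2_norm beta0"
    using beta0_carrier by (simp add: l0_norm_def l2_norm_def)
  also have "\<dots> \<le> sqrt (l0_norm beta0) * A"
    using A by (intro mult_left_mono) auto
  finally have b: "(\<Sum>j<p. \<bar>beta0 $ j\<bar>) \<le> sqrt (l0_norm beta0) * A" .
  have "l1_norm (bhat \<omega> - beta0) \<le> 2 * (\<Sum>j<p. \<bar>beta0 $ j\<bar>) + V / (2 * lam)"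
    unfolding l1_norm_error V_def
    by (rule lasso_basic_inequality_crude[OF lam n lasso_estimator_basic_inequality[OF est \<omega>]])
  also have "\<dots> \<le> sqrt (l0_norm beta0) * (2 * A) + V / 2 * (1 / lam)"
    using b by simp
  \<comment> \<open>Nonnegative cross terms are added so that the bound factors.\<close>
  also have "\<dots> \<le> sqrt (l0_norm beta0) * (2 * A + V / 2) + (2 * A + V / 2) * (1 / lam)"
    using V A0 lam by (intro add_mono mult_left_mono mult_right_mono) auto
  also have "\<dots> = (sqrt (l0_norm beta0) + 1 / lam) * (2 * A + V / 2)"
    by (simp add: algebra_simps)
  finally show ?thesis by (simp add: V_def)
qed

text \<open>The variable equals (K^2 / 2) (4 A / K^2 + V / K^2) with V the mean squared error term;
  x^m <= m! exp x then leaves only the exponential moment of V / K^2.\<close>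

lemma moment_crude_bound:
  assumes K: "K > 0" and n: "n \<ge> 1" and A: "A \<ge> 0"
  shows "integrable M (\<lambda>\<omega>. (2 * A + (\<Sum>i<n. (eps \<omega> $ i)\<^sup>2) / n / 2) ^ m)"
    and "expectation (\<lambda>\<omega>. (2 * A + (\<Sum>i<n. (eps \<omega> $ i)\<^sup>2) / n / 2) ^ m)
      \<le> fact m * (K\<^sup>2 / 2) ^ m * exp (4 * A / K\<^sup>2) * K2"
proof -
  define V where "V \<omega> = (\<Sum>i<n. (eps \<omega> $ i)\<^sup>2) / n" for \<omega>
  define D where "D = fact m * (K\<^sup>2 / 2) ^ m * exp (4 * A / K\<^sup>2)"
  have D: "D \<ge> 0" by (simp add: D_def)
  note exp_V = exp_mean_squared_errors[OF n, folded V_def]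
  have [measurable]: "V \<in> borel_measurable M" unfolding V_def by measurable
  have V0: "V \<omega> \<ge> 0" for \<omega> by (simp add: V_def sum_nonneg)
  have pw: "(2 * A + V \<omega> / 2) ^ m \<le> D * exp (V \<omega> / K\<^sup>2)" for \<omega>
  proof -
    have "2 * A + V \<omega> / 2 = (K\<^sup>2 / 2) * (4 * A / K\<^sup>2 + V \<omega> / K\<^sup>2)"
      using K by (simp add: field_simps)
    then have "(2 * A + V \<omega> / 2) ^ m = (K\<^sup>2 / 2) ^ m * (4 * A / K\<^sup>2 + V \<omega> / K\<^sup>2) ^ m"
      by (simp only: power_mult_distrib)
    also have "\<dots> \<le> (K\<^sup>2 / 2) ^ m * (fact m * exp (4 * A / K\<^sup>2 + V \<omega> / K\<^sup>2))"
      using A V0[of \<omega>] by (intro mult_left_mono power_le_fact_exp) auto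
    finally show ?thesis by (simp add: D_def exp_add mult_ac)
  qed
  have nn: "(2 * A + V \<omega> / 2) ^ m \<ge> 0" for \<omega> using A V0[of \<omega>] by simp
  have int: "integrable M (\<lambda>\<omega>. (2 * A + V \<omega> / 2) ^ m)"
  proof (rule Bochner_Integration.integrable_bound)
    show "integrable M (\<lambda>\<omega>. D * exp (V \<omega> / K\<^sup>2))" using exp_V by simp
    show "AE \<omega> in M. norm ((2 * A + V \<omega> / 2) ^ m) \<le> norm (D * exp (V \<omega> / K\<^sup>2))"
      using pw nn D by (intro AE_I2) (simp add: abs_of_nonneg del: norm_power abs_power_minus)
  qed measurable
  then show "integrable M (\<lambda>\<omega>. (2 * A + (\<Sum>i<n. (eps \<omega> $ i)\<^sup>2) / n / 2) ^ m)" by (simp add: V_def)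
  have "expectation (\<lambda>\<omega>. (2 * A + V \<omega> / 2) ^ m) \<le> expectation (\<lambda>\<omega>. D * exp (V \<omega> / K\<^sup>2))"
    using int exp_V pw by (intro integral_mono) auto
  also have "\<dots> \<le> D * K2" using exp_V D by (simp add: mult_left_mono)
  finally show "expectation (\<lambda>\<omega>. (2 * A + (\<Sum>i<n. (eps \<omega> $ i)\<^sup>2) / n / 2) ^ m)
      \<le> fact m * (K\<^sup>2 / 2) ^ m * exp (4 * A / K\<^sup>2) * K2"
    by (simp add: V_def D_def)
qed

lemma lasso_moment_crude:
  fixes k :: nat
  assumes K: "K > 0" and n: "n \<ge> 1" and lam: "lam > 0" and A: "l2_norm beta0 \<le> A"
    and est: "lasso_estimator M p X Y lam bhat"
  shows "integrable M (\<lambda>\<omega>. l1_norm (bhat \<omega> - beta0) ^ k)"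
    and "expectation (\<lambda>\<omega>. l1_norm (bhat \<omega> - beta0) ^ k) \<le>
      (sqrt (l0_norm beta0) + 1 / lam) ^ k * (fact k * (K\<^sup>2 / 2) ^ k * exp (4 * A / K\<^sup>2) * K2)"
proof -
  let ?u = "sqrt (l0_norm beta0) + 1 / lam"
  let ?Z = "\<lambda>\<omega>. 2 * A + (\<Sum>i<n. (eps \<omega> $ i)\<^sup>2) / n / 2"
  have "0 \<le> l2_norm beta0" by (simp add: l2_norm_def sum_nonneg)
  then have A0: "0 \<le> A" using A by linarith
  note mom = moment_crude_bound[OF K n A0, of k]
  have nn: "l1_norm (bhat \<omega> - beta0) \<ge> 0" for \<omega> by (simp add: l1_norm_def sum_nonneg)
  have pw: "l1_norm (bhat \<omega> - beta0) ^ k \<le> ?u ^ k * ?Z \<omega> ^ k" if "\<omega> \<in> space M" for \<omega>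
    using power_mono[OF l1_norm_error_crude[OF est that n lam A] nn, of k]
    by (simp add: power_mult_distrib)
  show int: "integrable M (\<lambda>\<omega>. l1_norm (bhat \<omega> - beta0) ^ k)"
  proof (rule Bochner_Integration.integrable_bound)
    show "integrable M (\<lambda>\<omega>. ?u ^ k * ?Z \<omega> ^ k)" using mom by simp
    show "(\<lambda>\<omega>. l1_norm (bhat \<omega> - beta0) ^ k) \<in> borel_measurable M"
      using measurable_l1_norm_error[OF est] by simp
    show "AE \<omega> in M. norm (l1_norm (bhat \<omega> - beta0) ^ k) \<le> norm (?u ^ k * ?Z \<omega> ^ k)"
      using pw nn by (intro AE_I2) (auto simp: intro!: order_trans[OF _ abs_ge_self])
  qed
  have "expectation (\<lambda>\<omega>. l1_norm (bhat \<omega> - beta0) ^ k) \<le> expectation (\<lambda>\<omega>. ?u ^ k * ?Z \<omega> ^ k)"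
    using int mom pw by (intro integral_mono) auto
  also have "\<dots> = ?u ^ k * expectation (\<lambda>\<omega>. ?Z \<omega> ^ k)" using mom(1) by simp
  also have "\<dots> \<le> ?u ^ k * (fact k * (K\<^sup>2 / 2) ^ k * exp (4 * A / K\<^sup>2) * K2)"
    using mom(2) lam by (intro mult_left_mono) auto
  finally show "expectation (\<lambda>\<omega>. l1_norm (bhat \<omega> - beta0) ^ k) \<le>
      ?u ^ k * (fact k * (K\<^sup>2 / 2) ^ k * exp (4 * A / K\<^sup>2) * K2)" .
qed

text \<open>On the exceptional event the crude bound is split by y <= (x y^2 + 1/x) / 2, with x matching the square
  root of the probability of the event.\<close>

lemma lasso_moment_off_event:
  fixes k :: nat and Q r :: real
  assumes K: "K > 0" and n: "n \<ge> 1" and lam: "lam > 0" and A: "l2_norm beta0 \<le> A"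
    and est: "lasso_estimator M p X Y lam bhat"
    and Bd: "Bd \<in> events" "prob Bd \<le> 4 * r ^ (2 * k)" and r: "r > 0"
    and good: "\<And>\<omega>. \<omega> \<in> space M - Bd \<Longrightarrow> l1_norm (bhat \<omega> - beta0) \<le> Q" and Q: "Q \<ge> 0"
  shows "expectation (\<lambda>\<omega>. l1_norm (bhat \<omega> - beta0) ^ k) \<le> Q ^ k +
      ((sqrt (l0_norm beta0) + 1 / lam) * r) ^ k *
        ((fact (2 * k) * (K\<^sup>2 / 2) ^ (2 * k) * exp (4 * A / K\<^sup>2) * K2 + 4) / 2)"
proof -
  let ?u = "sqrt (l0_norm beta0) + 1 / lam"
  let ?Z = "\<lambda>\<omega>. 2 * A + (\<Sum>i<n. (eps \<omega> $ i)\<^sup>2) / n / 2"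
  let ?G = "fact (2 * k) * (K\<^sup>2 / 2) ^ (2 * k) * exp (4 * A / K\<^sup>2) * K2"
  \<comment> \<open>One dominating function for both cases: off \<open>Bd\<close> the term
    \<open>Q ^ k\<close> suffices and the rest is nonnegative, on \<open>Bd\<close> the indicator
    supplies the 1/x of the split. Its expectation involves only a moment of order 2 k and
    \<open>prob Bd\<close>.\<close>
  let ?F = "\<lambda>\<omega>. Q ^ k + ?u ^ k * ((r ^ k * ?Z \<omega> ^ (2 * k) + indicator Bd \<omega> / r ^ k) / 2)"
  have "0 \<le> l2_norm beta0" by (simp add: l2_norm_def sum_nonneg)
  then have A0: "0 \<le> A" using A by linarith
  note mom = moment_crude_bound[OF K n A0, of "2 * k"]
  have nn: "l1_norm (bhat \<omega> - beta0) \<ge> 0" for \<omega> by (simp add: l1_norm_def sum_nonneg)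
  have u: "?u > 0" using lam by (simp add: add_nonneg_pos)
  have pw: "l1_norm (bhat \<omega> - beta0) ^ k \<le> ?F \<omega>" if \<omega>: "\<omega> \<in> space M" for \<omega>
  proof (cases "\<omega> \<in> Bd")
    case True
    let ?y = "?Z \<omega> ^ k"
    have rk: "r ^ k > 0" using r by simp
    then have "?y \<le> (r ^ k * ?y\<^sup>2 + 1 / r ^ k) / 2"
      by (rule weighted_am_gm)
    then have y: "?y \<le> (r ^ k * ?Z \<omega> ^ (2 * k) + 1 / r ^ k) / 2"
      by (simp add: power_mult[symmetric] mult.commute)
    have "l1_norm (bhat \<omega> - beta0) ^ k \<le> ?u ^ k * ?y"
      using power_mono[OF l1_norm_error_crude[OF est \<omega> n lam A] nn, of k]
      by (simp add: power_mult_distrib)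
    also have "\<dots> \<le> ?u ^ k * ((r ^ k * ?Z \<omega> ^ (2 * k) + 1 / r ^ k) / 2)"
      using y u by (intro mult_left_mono) auto
    also have "\<dots> \<le> ?F \<omega>" using True Q by simp
    finally show ?thesis .
  next
    case False
    have "?Z \<omega> ^ (2 * k) \<ge> 0" by (rule zero_le_even_power) simp
    then have "0 \<le> ?u ^ k * ((r ^ k * ?Z \<omega> ^ (2 * k) + indicator Bd \<omega> / r ^ k) / 2)"
      using u r False by (intro mult_nonneg_nonneg divide_nonneg_nonneg add_nonneg_nonneg) auto
    moreover have "l1_norm (bhat \<omega> - beta0) ^ k \<le> Q ^ k"
      using False \<omega> by (intro power_mono good nn) auto
    ultimately show ?thesis by linarith
  qed
  have alg: "Q ^ k + u ^ k * ((r ^ k * g + r ^ k * 4) / 2) = Q ^ k + (u * r) ^ k * ((g + 4) / 2)" for u g :: real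
    by (simp add: power_mult_distrib field_simps)
  have ind: "integrable M (indicator Bd :: 'a \<Rightarrow> real)"
    using Bd(1) by (intro integrable_real_indicator) (auto simp: emeasure_eq_measure)
  have intF: "integrable M ?F" using mom(1) ind by auto
  have "expectation (\<lambda>\<omega>. l1_norm (bhat \<omega> - beta0) ^ k) \<le> expectation ?F"
    using lasso_moment_crude(1)[OF K n lam A est] intF pw by (intro integral_mono) auto
  also have "\<dots> = Q ^ k + ?u ^ k * ((r ^ k * expectation (\<lambda>\<omega>. ?Z \<omega> ^ (2 * k)) + prob Bd / r ^ k) / 2)"
    using mom(1) ind Bd by (simp add: prob_space)
  also have "\<dots> \<le> Q ^ k + ?u ^ k * ((r ^ k * ?G + 4 * r ^ (2 * k) / r ^ k) / 2)"
    using mom(2) Bd(2) r u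
    by (intro add_left_mono mult_left_mono divide_right_mono add_mono) auto
  also have "4 * r ^ (2 * k) / r ^ k = r ^ k * 4"
    using r by (simp add: mult_2 power_add)
  also have "Q ^ k + ?u ^ k * ((r ^ k * ?G + r ^ k * 4) / 2) = Q ^ k + (?u * r) ^ k * ((?G + 4) / 2)"
    by (rule alg)
  finally show ?thesis .
qed

end

section \<open>Constants, event probabilities and the two regimes of lam\<close>

lemma half_le_ln:
  assumes "p \<ge> (2::nat)"
  shows "1 / 2 \<le> ln (real p)"
proof -
  have "ln (1 / 2 :: real) \<le> 1 / 2 - 1" by (intro ln_le_minus_one) auto
  then have "1 / 2 \<le> ln (2 :: real)" by (simp add: ln_div)
  also have "\<dots> \<le> ln (real p)" using assms by simp
  finally show ?thesis .
qed

lemma sqrt_le_self: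
  fixes x :: real
  assumes "x \<ge> 1"
  shows "sqrt x \<le> x"
  using assms by (intro real_le_lsqrt) (auto simp: power2_eq_square)

text \<open>Above this threshold the crude bound is already of order s lam; below it, the deviation lam / 2 lies in the
  Gaussian range of Bernstein's inequality.\<close>

definition lasso_threshold :: "real \<Rightarrow> real \<Rightarrow> real" where
  "lasso_threshold K K2 = min 1 (8 * K\<^sup>2 * K2)"

text \<open>The bound of \<open>moment_crude_bound\<close> for the m-th moment of the random factor
  in the crude estimate.\<close>

definition crude_constant :: "real \<Rightarrow> real \<Rightarrow> real \<Rightarrow> nat \<Rightarrow> real" where
  "crude_constant K K2 A m = fact m * (K\<^sup>2 / 2) ^ m * exp (4 * A / K\<^sup>2) * K2"

text \<open>The first summand serves lam above the threshold. Below it, (24 / kap)^k comes from the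
  good event and the last term from the exceptional one. The sum covers both regimes.\<close>

definition lasso_constant :: "real \<Rightarrow> real \<Rightarrow> nat \<Rightarrow> real \<Rightarrow> real \<Rightarrow> real" where
  "lasso_constant K K2 k A kap =
    (1 / lasso_threshold K K2 + 1 / (lasso_threshold K K2)\<^sup>2) ^ k * crude_constant K K2 A k +
    ((24 / kap) ^ k + 2 ^ k * ((crude_constant K K2 A (2 * k) + 4) / 2))"

text \<open>With entrywise accuracy gram_precision / s the quadratic form is perturbed by at most half of
  kap |d|_2^2 on the cone |d|_1^2 <= 16 s |d|_2^2.\<close>

definition gram_precision :: "real \<Rightarrow> real \<Rightarrow> real \<Rightarrow> real" where
  "gram_precision K K2 kap = min (kap / 32) (4 * K\<^sup>2 * K2)"

context sub_gaussian_linear_model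
begin

text \<open>With t the threshold, lam >= t and s >= 1 give sqrt s <= s lam / t and 1 / lam <= s lam
  / t^2.\<close>

lemma lasso_moment_large_penalty:
  fixes k :: nat
  assumes K: "K > 0" "K2 > 0" and n: "n \<ge> 1" and A: "l2_norm beta0 \<le> A"
    and lam: "lam \<ge> lasso_threshold K K2" and s: "s = l0_norm beta0" "s \<ge> 1"
    and est: "lasso_estimator M p X Y lam bhat"
  shows "expectation (\<lambda>\<omega>. l1_norm (bhat \<omega> - beta0) ^ k) \<le>
    (1 / lasso_threshold K K2 + 1 / (lasso_threshold K K2)\<^sup>2) ^ k * crude_constant K K2 A k * (s * lam) ^ k"
proof -
  define t where "t = lasso_threshold K K2"
  have t: "t > 0" "t \<le> lam" using K lam by (auto simp: t_def lasso_threshold_def)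
  have lam0: "lam > 0" using t by linarith
  have s1: "real s \<ge> 1" using s by simp
  then have "sqrt s * 1 \<le> s * (lam / t)" using t s1 sqrt_le_self by (intro mult_mono) auto
  moreover have "1 / lam \<le> s * (lam / t\<^sup>2)"
  proof -
    have "t\<^sup>2 \<le> lam\<^sup>2" using t by (intro power_mono) auto
    then have "1 / lam \<le> lam / t\<^sup>2"
      using t lam0 by (simp add: field_simps power2_eq_square)
    also have "\<dots> \<le> s * (lam / t\<^sup>2)" using s1 lam0 mult_right_mono[of 1 "real s" "lam / t\<^sup>2"] by simp
    finally show ?thesis .
  qed
  ultimately have "sqrt s + 1 / lam \<le> (1 / t + 1 / t\<^sup>2) * (s * lam)"
    by (simp add: algebra_simps)
  then have "(sqrt s + 1 / lam) ^ k \<le> ((1 / t + 1 / t\<^sup>2) * (s * lam)) ^ k"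
    using lam0 by (intro power_mono) auto
  then have "(sqrt s + 1 / lam) ^ k * crude_constant K K2 A k \<le>
     ((1 / t + 1 / t\<^sup>2) * (s * lam)) ^ k * crude_constant K K2 A k"
    using K by (intro mult_right_mono) (auto simp: crude_constant_def)
  then show ?thesis
    using lasso_moment_crude(2)[OF K(1) n lam0 A est, of k]
    by (simp add: s(1) t_def crude_constant_def power_mult_distrib mult_ac)
qed

text \<open>Deviation lam / 2 has exponent n lam^2 / (64 K^4 K2), which 128 K^4 K2 <= c^2 makes at
  least 2 tau^2 ln p. One half pays for the union bound since tau > 1; the other exceeds 2 k ln (1 /
  r) by the assumption on tau.\<close>

lemma noise_event_prob:
  fixes k :: nat
  assumes K: "K > 0" "K2 > 0" and n: "n \<ge> 1" and p: "p \<ge> 2"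
    and c: "c \<ge> 0" "128 * K ^ 4 * K2 \<le> c\<^sup>2"
    and tau: "tau > 1" "tau\<^sup>2 > 2 * real k * ln (inverse r) / ln (real p)" and r: "r > 0"
    and lam: "lam \<ge> c * tau * sqrt (ln (real p) / real n)" "0 < lam" "lam \<le> 8 * K\<^sup>2 * K2"
  shows "prob {\<omega> \<in> space M. \<exists>j<p. lam / 2 \<le> \<bar>(\<Sum>i<n. X \<omega> $$ (i, j) * eps \<omega> $ i) / n\<bar>} \<le> 2 * r ^ (2 * k)"
proof -
  define \<tau> where "\<tau> = tau\<^sup>2"
  define L where "L = ln (real p)"
  have L: "L > 0" using half_le_ln[OF p] by (simp add: L_def)
  have t1: "\<tau> \<ge> 1" using tau(1) by (simp add: \<tau>_def one_le_power)
  have "(c * tau * sqrt (L / n))\<^sup>2 \<le> lam\<^sup>2"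
    using lam c tau L by (intro power_mono) (auto simp: L_def)
  then have "c\<^sup>2 * \<tau> * (L / n) \<le> lam\<^sup>2" using L by (simp add: power_mult_distrib \<tau>_def)
  then have nl: "c\<^sup>2 * \<tau> * L \<le> n * lam\<^sup>2" using n by (simp add: field_simps)
  have "128 * K ^ 4 * K2 * (\<tau> * L) \<le> c\<^sup>2 * (\<tau> * L)"
    using c(2) t1 L by (intro mult_right_mono) auto
  then have "128 * K ^ 4 * K2 * (\<tau> * L) \<le> n * lam\<^sup>2" using nl by (simp add: mult_ac)
  then have ex: "2 * (\<tau> * L) \<le> n * (lam / 2)\<^sup>2 / (16 * K ^ 4 * K2)"
    using K by (simp add: field_simps power_divide)
  have "L \<le> \<tau> * L" using t1 L by simp
  then have ex2: "L - n * (lam / 2)\<^sup>2 / (16 * K ^ 4 * K2) \<le> - (\<tau> * L)" using ex by linarith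
  have "2 * real k * ln (inverse r) < \<tau> * L"
    using tau(2) L by (simp add: \<tau>_def L_def divide_less_eq)
  then have ex3: "- (\<tau> * L) \<le> 2 * real k * ln r" using r by (simp add: ln_inverse)
  have "prob {\<omega> \<in> space M. \<exists>j<p. lam / 2 \<le> \<bar>(\<Sum>i<n. X \<omega> $$ (i, j) * eps \<omega> $ i) / n\<bar>}
    \<le> p * (2 * exp (- (n * (lam / 2)\<^sup>2 / (16 * K ^ 4 * K2))))"
    using lam by (intro noise_tail K n) auto
  also have "\<dots> = 2 * exp (L - n * (lam / 2)\<^sup>2 / (16 * K ^ 4 * K2))"
    using p by (simp add: L_def exp_diff exp_minus field_simps)
  also have "\<dots> \<le> 2 * exp (2 * real k * ln r)"
    using ex2 ex3 by simp
  also have "\<dots> = 2 * r ^ (2 * k)"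
    using r exp_of_nat_mult[of "2 * k" "ln r"] by simp
  finally show ?thesis .
qed

text \<open>In \<open>size\<close>, 2 ln p pays for the union bound over pairs and 2 k ln n leaves
  n^(-2k), which 1 / n <= r turns into the required power of r.\<close>

lemma gram_event_prob:
  fixes k :: nat and a :: real
  assumes K: "K > 0" "K2 > 0" and n: "n \<ge> 1" and p: "p \<ge> 2" and a: "0 \<le> a" "a \<le> 4 * K\<^sup>2 * K2"
    and r: "1 / n \<le> r"
    and size: "2 * ln (real p) + 2 * real k * ln (real n) \<le> n * a\<^sup>2 / (16 * K ^ 4 * K2)"
  shows "prob {\<omega> \<in> space M. \<exists>j<p. \<exists>l<p.
      a \<le> \<bar>(\<Sum>i<n. X \<omega> $$ (i, j) * X \<omega> $$ (i, l)) / n - mean_gram M p X $$ (j, l)\<bar>} \<le> 2 * r ^ (2 * k)"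
proof -
  have "prob {\<omega> \<in> space M. \<exists>j<p. \<exists>l<p.
      a \<le> \<bar>(\<Sum>i<n. X \<omega> $$ (i, j) * X \<omega> $$ (i, l)) / n - mean_gram M p X $$ (j, l)\<bar>}
    \<le> (real p)\<^sup>2 * (2 * exp (- (n * a\<^sup>2 / (16 * K ^ 4 * K2))))"
    by (rule gram_tail[OF K n a])
  also have "(real p)\<^sup>2 = exp (2 * ln (real p))" using p by (simp add: exp_double)
  also have "\<dots> * (2 * exp (- (n * a\<^sup>2 / (16 * K ^ 4 * K2)))) = 2 * exp (2 * ln (real p) - n * a\<^sup>2 / (16 * K ^ 4 * K2))"
    by (simp add: exp_diff exp_minus field_simps)
  also have "\<dots> \<le> 2 * exp (real (2 * k) * ln (1 / n))"
    using size n by (simp add: ln_div)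
  also have "\<dots> = 2 * (1 / n) ^ (2 * k)"
    unfolding exp_of_nat_mult using n by simp
  also have "\<dots> \<le> 2 * r ^ (2 * k)"
    using r by (intro mult_left_mono power_mono) auto
  finally show ?thesis .
qed

lemma mean_gram_symmetric: "j < p \<Longrightarrow> l < p \<Longrightarrow> mean_gram M p X $$ (j, l) = mean_gram M p X $$ (l, j)"
  by (simp add: mean_gram_def gram_entry mult.commute cong: Bochner_Integration.integral_cong)

lemma l1_norm_error_good_event:
  fixes a :: real
  assumes n: "n \<ge> 1" and p: "p \<ge> 1" and lam: "lam > 0" and kap: "kap > 0" "kap \<le> min_eigenvalue (mean_gram M p X)"
    and est: "lasso_estimator M p X Y lam bhat" and \<omega>: "\<omega> \<in> space M"
    and s: "s = l0_norm beta0" "s \<ge> 1" and a: "0 \<le> a" "32 * a \<le> kap"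
    and noise: "\<not> (\<exists>j<p. lam / 2 \<le> \<bar>(\<Sum>i<n. X \<omega> $$ (i, j) * eps \<omega> $ i) / n\<bar>)"
    and gram: "\<not> (\<exists>j<p. \<exists>l<p.
      a / s \<le> \<bar>(\<Sum>i<n. X \<omega> $$ (i, j) * X \<omega> $$ (i, l)) / n - mean_gram M p X $$ (j, l)\<bar>)"
  shows "l1_norm (bhat \<omega> - beta0) \<le> 24 / kap * (s * lam)"
proof -
  let ?d = "\<lambda>j. bhat \<omega> $ j - beta0 $ j"
  have "kap * (\<Sum>j<p. (?d j)\<^sup>2) \<le> min_eigenvalue (mean_gram M p X) * (\<Sum>j<p. (?d j)\<^sup>2)"
    using kap by (intro mult_right_mono sum_nonneg) auto
  also have "\<dots> \<le> (\<Sum>j<p. \<Sum>l<p. mean_gram M p X $$ (j, l) * ?d j * ?d l)"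
    using p mean_gram_symmetric by (intro min_eigenvalue_le_quadratic_form) (auto simp: mean_gram_def)
  finally have eig: "kap * (\<Sum>j<p. (?d j)\<^sup>2) \<le> (\<Sum>j<p. \<Sum>l<p. mean_gram M p X $$ (j, l) * ?d j * ?d l)" .
  have "(\<Sum>j<p. \<bar>?d j\<bar>) \<le> 24 * real s * lam / kap"
  proof (rule lasso_oracle_inequality[OF lam n kap(1) lasso_estimator_basic_inequality[OF est \<omega>] _ _ eig, where \<eta> = "a / s"])
    show "s = card {j. j < p \<and> beta0 $ j \<noteq> 0}"
      using beta0_carrier s by (simp add: l0_norm_def)
    show "32 * (a / s) * real s \<le> kap" using a s by simp
  qed (use noise gram a in \<open>auto simp: not_le less_imp_le\<close>)
  then show ?thesis by (simp add: l1_norm_error mult_ac)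
qed

text \<open>The nonasymptotic core: the asymptotic assumptions enter only through
  \<open>kap\<close>, \<open>A\<close> and the inequality \<open>size\<close>, so one constant
  serves every n that meets them.\<close>

lemma lasso_moment_bound:
  fixes k :: nat
  assumes K: "K > 0" "K2 > 0" and n: "n \<ge> 1" and p: "p \<ge> 2"
    and s: "s = l0_norm beta0" "s \<ge> 1" and A: "l2_norm beta0 \<le> A"
    and kap: "kap > 0" "kap \<le> min_eigenvalue (mean_gram M p X)"
    and c: "c > 0" "128 * K ^ 4 * K2 + 4 \<le> c\<^sup>2"
    and lam: "lam \<ge> c * tau * sqrt (ln (real p) / real n)"
    and tau: "tau > 1" "tau\<^sup>2 > 2 * real k * ln (inverse (sqrt (real s) * lam\<^sup>2)) / ln (real p)"
    and size: "2 * ln (real p) + 2 * real k * ln (real n) \<le>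
      (gram_precision K K2 kap)\<^sup>2 / (16 * K ^ 4 * K2) * (n / (real s)\<^sup>2)"
    and est: "lasso_estimator M p X Y lam bhat"
  shows "expectation (\<lambda>\<omega>. l1_norm (bhat \<omega> - beta0) ^ k) \<le> lasso_constant K K2 k A kap * (s * lam) ^ k"
proof -
  define a where "a = gram_precision K K2 kap"
  define t where "t = lasso_threshold K K2"
  define L where "L = ln (real p)"
  define r where "r = sqrt s * lam\<^sup>2"
  have L: "L \<ge> 1 / 2" using half_le_ln[OF p] by (simp add: L_def)
  have "c * tau * sqrt (L / n) > 0"
    using c tau L n by (intro mult_pos_pos) auto
  then have lam0: "lam > 0" using lam by (simp add: L_def)
  have t0: "t > 0" using K by (simp add: t_def lasso_threshold_def)
  have C1: "(1 / t + 1 / t\<^sup>2) ^ k * crude_constant K K2 A k \<ge> 0"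
    using t0 K by (simp add: crude_constant_def)
  have C2: "(24 / kap) ^ k + 2 ^ k * ((crude_constant K K2 A (2 * k) + 4) / 2) \<ge> 0"
    using kap K by (simp add: crude_constant_def)
  have sl: "(s * lam) ^ k \<ge> 0" using lam0 by simp
  show ?thesis
  proof (cases "lam \<ge> t")
    case True
    have "expectation (\<lambda>\<omega>. l1_norm (bhat \<omega> - beta0) ^ k) \<le>
      (1 / t + 1 / t\<^sup>2) ^ k * crude_constant K K2 A k * (s * lam) ^ k"
      using lasso_moment_large_penalty[OF K n A _ s est] True by (simp add: t_def)
    also have "\<dots> \<le> lasso_constant K K2 k A kap * (s * lam) ^ k"
      using C2 sl unfolding lasso_constant_def t_def[symmetric] by (intro mult_right_mono) auto
    finally show ?thesis .
  next
    case False
    then have lam1: "lam \<le> 1" "lam \<le> 8 * K\<^sup>2 * K2" by (auto simp: t_def lasso_threshold_def)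
    have s1: "real s \<ge> 1" using s by simp
    have a0: "0 < a" "32 * a \<le> kap" "a \<le> 4 * K\<^sup>2 * K2"
      using K kap by (auto simp: a_def gram_precision_def)
    have "a / s \<le> a / 1" using a0 s1 by (intro divide_left_mono) auto
    then have as: "0 \<le> a / s" "a / s \<le> 4 * K\<^sup>2 * K2" using a0 by auto
    have r0: "r > 0" using s lam0 by (simp add: r_def)
    have "(c * tau * sqrt (L / n))\<^sup>2 \<le> lam\<^sup>2"
      using lam c tau L by (intro power_mono) (auto simp: L_def)
    then have l2: "c\<^sup>2 * tau\<^sup>2 * (L / n) \<le> lam\<^sup>2" using L by (simp add: power_mult_distrib)
    have "128 * K ^ 4 * K2 \<ge> 0" using K by simp
    then have c4: "4 \<le> c\<^sup>2" and c128: "128 * K ^ 4 * K2 \<le> c\<^sup>2" using c(2) by linarith+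
    \<comment> \<open>The summand 4 in the condition on \<open>c\<close> is spent here, together
      with ln p >= 1/2.\<close>
    have "1 / n \<le> 4 * 1 * (1 / 2 / n)" using n by (simp add: field_simps)
    also have "\<dots> \<le> c\<^sup>2 * tau\<^sup>2 * (L / n)"
      using c4 tau(1) L by (intro mult_mono divide_right_mono) (auto simp: one_le_power)
    also note l2
    also have "lam\<^sup>2 = 1 * lam\<^sup>2" by simp
    also have "\<dots> \<le> r" unfolding r_def using s1 by (intro mult_right_mono) auto
    finally have rn: "1 / n \<le> r" .
    let ?N = "{\<omega> \<in> space M. \<exists>j<p. lam / 2 \<le> \<bar>(\<Sum>i<n. X \<omega> $$ (i, j) * eps \<omega> $ i) / n\<bar>}"
    let ?G = "{\<omega> \<in> space M. \<exists>j<p. \<exists>l<p.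
      a / s \<le> \<bar>(\<Sum>i<n. X \<omega> $$ (i, j) * X \<omega> $$ (i, l)) / n - mean_gram M p X $$ (j, l)\<bar>}"
    have N: "prob ?N \<le> 2 * r ^ (2 * k)"
      using c(1) c128 tau lam lam0 lam1 r0 by (intro noise_event_prob[where c = c and tau = tau] K n p) (auto simp: r_def)
    have "2 * ln (real p) + 2 * real k * ln (real n) \<le> n * (a / s)\<^sup>2 / (16 * K ^ 4 * K2)"
      using size by (simp add: a_def power_divide mult_ac)
    then have G: "prob ?G \<le> 2 * r ^ (2 * k)"
      by (intro gram_event_prob K n p as rn)
    have NG: "?N \<in> events" "?G \<in> events" by measurable
    have "prob (?N \<union> ?G) \<le> prob ?N + prob ?G" using NG by (rule measure_Un_le)
    then have Bd: "prob (?N \<union> ?G) \<le> 4 * r ^ (2 * k)" using N G by linarith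
    have "expectation (\<lambda>\<omega>. l1_norm (bhat \<omega> - beta0) ^ k) \<le> (24 / kap * (s * lam)) ^ k +
      ((sqrt (l0_norm beta0) + 1 / lam) * r) ^ k *
        ((fact (2 * k) * (K\<^sup>2 / 2) ^ (2 * k) * exp (4 * A / K\<^sup>2) * K2 + 4) / 2)"
    proof (rule lasso_moment_off_event[OF K(1) n lam0 A est _ Bd r0])
      show "?N \<union> ?G \<in> events" using NG by blast
      show "l1_norm (bhat \<omega> - beta0) \<le> 24 / kap * (s * lam)" if "\<omega> \<in> space M - (?N \<union> ?G)" for \<omega>
        using that a0 p by (intro l1_norm_error_good_event[OF n _ lam0 kap est _ s, of _ a]) auto
      show "0 \<le> 24 / kap * (s * lam)" using kap lam0 by simp
    qed
    also have "\<dots> = (24 / kap) ^ k * (s * lam) ^ k +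
      ((sqrt s + 1 / lam) * r) ^ k * ((crude_constant K K2 A (2 * k) + 4) / 2)"
      by (simp only: s(1) crude_constant_def power_mult_distrib[of "24 / kap"])
    also have "\<dots> \<le> (24 / kap) ^ k * (s * lam) ^ k + (2 * (s * lam)) ^ k * ((crude_constant K K2 A (2 * k) + 4) / 2)"
    proof (intro add_left_mono mult_right_mono power_mono)
      \<comment> \<open>The first term of the product uses lam <= 1, the second sqrt s <= s.\<close>
      have "sqrt s * sqrt s = s" by simp
      then have "(sqrt s + 1 / lam) * r = s * (lam * lam) + sqrt s * lam"
        using lam0 by (simp add: r_def power2_eq_square algebra_simps)
      also have "\<dots> \<le> s * (lam * 1) + s * lam"
        using lam0 lam1 s1 by (intro add_mono mult_left_mono mult_right_mono) (auto intro: sqrt_le_self)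
      finally show "(sqrt s + 1 / lam) * r \<le> 2 * (s * lam)" by (simp add: mult_ac)
      show "0 \<le> (sqrt s + 1 / lam) * r" using lam0 r0 by simp
      show "0 \<le> (crude_constant K K2 A (2 * k) + 4) / 2" using K by (simp add: crude_constant_def)
    qed
    also have "\<dots> = ((24 / kap) ^ k + 2 ^ k * ((crude_constant K K2 A (2 * k) + 4) / 2)) * (s * lam) ^ k"
      unfolding power_mult_distrib[of 2 "real s * lam"] by (simp only: distrib_left distrib_right mult_ac)
    also have "\<dots> \<le> lasso_constant K K2 k A kap * (s * lam) ^ k"
      using C1 sl unfolding lasso_constant_def t_def[symmetric] by (intro mult_right_mono) auto
    finally show ?thesis .
  qed
qed

end

section \<open>From asymptotic assumptions to a constant valid for all n\<close>

text \<open>That n / s^2 dominates ln n is clear if s^2 <= sqrt n; otherwise p >= s forces 4 ln p >= ln n.\<close>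

lemma eventually_sample_size:
  fixes s p :: "nat \<Rightarrow> nat" and \<kappa> m :: real
  assumes small: "(\<lambda>n. real (s n) * sqrt (ln (real (p n)) / real n)) \<in> o(\<lambda>_. 1)"
    and p: "\<And>n. n \<ge> 1 \<Longrightarrow> p n \<ge> 2" and s: "\<And>n. n \<ge> 1 \<Longrightarrow> s n \<ge> 1 \<and> s n \<le> p n"
    and \<kappa>: "\<kappa> > 0" and m: "m \<ge> 0"
  shows "\<forall>\<^sub>F n in sequentially. 2 * ln (real (p n)) + m * ln (real n) \<le> \<kappa> * (n / (real (s n))\<^sup>2)"
proof -
  \<comment> \<open>Each of 2 ln p and m ln n may use half of the budget: the first needs kappa / 4,
    the second kappa / (8 (m + 1)) because ln n <= 4 ln p in the case where it is used. Taking m + 1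
    avoids a zero denominator.\<close>
  define \<delta> where "\<delta> = min (\<kappa> / 4) (\<kappa> / (8 * (m + 1)))"
  have \<delta>: "\<delta> > 0" "\<delta> \<le> \<kappa> / 4" "\<delta> \<le> \<kappa> / (8 * (m + 1))"
  proof -
    show "\<delta> > 0" using \<kappa> m by (simp add: \<delta>_def)
  qed (simp_all only: \<delta>_def min.cobounded1 min.cobounded2)
  have ev1: "\<forall>\<^sub>F n in sequentially. norm (real (s n) * sqrt (ln (real (p n)) / real n)) \<le> sqrt \<delta> * norm (1::real)"
    using landau_o.smallD[OF small, of "sqrt \<delta>"] \<delta> by simp
  have "(\<lambda>n. ln (real n) / real n powr (1 / 2)) \<longlonglongrightarrow> 0"
    by (rule lim_ln_over_power) auto
  then have "\<forall>\<^sub>F n in sequentially. ln (real n) / real n powr (1 / 2) < \<kappa> / (2 * (m + 1))"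
    using \<kappa> m by (intro order_tendstoD(2)[where y = 0]) auto
  with ev1 eventually_ge_at_top[of 1] show ?thesis
  proof eventually_elim
    case (elim n)
    define S where "S = (real (s n))\<^sup>2"
    define L where "L = ln (real (p n))"
    have s1: "real (s n) \<ge> 1" using s[OF elim(2)] by simp
    have S: "S \<ge> 1" using s1 by (simp add: S_def one_le_power)
    have n0: "real n > 0" using elim by simp
    have lnn: "ln (real n) \<ge> 0" using elim(2) by simp
    have L: "L \<ge> 1 / 2" using half_le_ln[OF p[OF elim(2)]] by (simp add: L_def)
    have "(real (s n) * sqrt (L / n))\<^sup>2 \<le> (sqrt \<delta>)\<^sup>2"
      using elim(1) L n0 by (intro power_mono) (auto simp: L_def)
    then have "S * (L / n) \<le> \<delta>" using \<delta> L n0 by (simp add: power_mult_distrib S_def)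
    then have SL: "L \<le> \<delta> * (n / S)" using n0 S by (simp add: field_simps)
    have nS: "n / S \<ge> 0" using S by simp
    have "2 * L \<le> 2 * (\<kappa> / 4 * (n / S))"
      using SL mult_right_mono[OF \<delta>(2) nS] by linarith
    then have part1: "2 * L \<le> \<kappa> / 2 * (n / S)" by simp
    have part2: "m * ln n \<le> \<kappa> / 2 * (n / S)"
    proof (cases "S \<le> sqrt n")
      case True
      have "ln n \<le> \<kappa> / (2 * (m + 1)) * sqrt n"
        using elim(3) n0 by (simp add: powr_half_sqrt divide_less_eq)
      then have "(m + 1) * ln n \<le> (m + 1) * (\<kappa> / (2 * (m + 1)) * sqrt n)"
        using m by (intro mult_left_mono) auto
      also have "\<dots> = \<kappa> / 2 * sqrt n" using m by (simp add: field_simps)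
      also have "\<dots> = \<kappa> / 2 * (n / sqrt n)" by (simp add: real_div_sqrt)
      also have "\<dots> \<le> \<kappa> / 2 * (n / S)"
        using True S \<kappa> n0 by (intro mult_left_mono divide_left_mono) auto
      finally show ?thesis using lnn by (simp add: distrib_right)
    next
      case False
      then have "sqrt n \<le> S" by simp
      then have "n \<le> S\<^sup>2" using n0 sqrt_le_D by blast
      then have "ln n \<le> ln (S\<^sup>2)" using n0 S by simp
      also have "\<dots> = 4 * ln (s n)" using s1 by (simp add: S_def ln_realpow)
      also have "\<dots> \<le> 4 * L" using s[OF elim(2)] by (simp add: L_def)
      finally have lnL: "ln n \<le> 4 * L" .
      have "m * ln n \<le> (m + 1) * (4 * L)"
        using lnL m lnn by (intro mult_mono) auto
      also have "\<dots> \<le> (m + 1) * (4 * (\<kappa> / (8 * (m + 1)) * (n / S)))"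
        using SL mult_right_mono[OF \<delta>(3) nS] m by (intro mult_left_mono) auto
      also have "\<dots> = 4 * (\<kappa> / (8 * (m + 1)) * (m + 1)) * (n / S)" by (simp only: mult_ac)
      also have "\<kappa> / (8 * (m + 1)) * (m + 1) = \<kappa> / 8"
        using m by (simp add: divide_eq_eq algebra_simps)
      finally show ?thesis by simp
    qed
    show ?case using part1 part2 by (simp add: L_def S_def)
  qed
qed

text \<open>The threshold \<open>c0\<close> is fixed before the sequence of models, while
  \<open>C1\<close> may depend on that sequence but not on n. Integrability is part of the
  conclusion because the integral of a non-integrable function is 0, which would make the bound
  empty.\<close>

theorem theorem1:
  fixes K K2 :: real and k :: nat
  assumes "K > 0" and "K2 > 0" and "k \<ge> 1"
  shows "\<exists>c0>0. \<forall>c\<ge>c0.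
    \<forall>(M :: nat \<Rightarrow> 'a measure) (p :: nat \<Rightarrow> nat) (X :: nat \<Rightarrow> 'a \<Rightarrow> real mat)
      (eps :: nat \<Rightarrow> 'a \<Rightarrow> real vec) (Y :: nat \<Rightarrow> 'a \<Rightarrow> real vec) (beta0 :: nat \<Rightarrow> real vec)
      (s :: nat \<Rightarrow> nat) (lam :: nat \<Rightarrow> real) (tau :: nat \<Rightarrow> real) (bhat :: nat \<Rightarrow> 'a \<Rightarrow> real vec).
      (\<forall>n\<ge>1. sub_gaussian_linear_model (M n) n (p n) (X n) (eps n) (Y n) (beta0 n) K K2) \<longrightarrow>
      (\<forall>n\<ge>1. p n \<ge> 2) \<longrightarrow>
      (\<forall>n\<ge>1. s n = l0_norm (beta0 n) \<and> s n \<ge> 1) \<longrightarrow>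
      (\<forall>n\<ge>1. min_eigenvalue (mean_gram (M n) (p n) (X n)) > 0) \<longrightarrow>
      (\<lambda>n. 1 / min_eigenvalue (mean_gram (M n) (p n) (X n))) \<in> O(\<lambda>_. 1) \<longrightarrow>
      (\<lambda>n. l2_norm (beta0 n)) \<in> O(\<lambda>_. 1) \<longrightarrow>
      (\<lambda>n. real (s n) * sqrt (ln (real (p n)) / real n)) \<in> o(\<lambda>_. 1) \<longrightarrow>
      (\<forall>n\<ge>1. lam n \<ge> c * tau n * sqrt (ln (real (p n)) / real n)) \<longrightarrow>
      (\<forall>n\<ge>1. tau n > 1 \<and>
         (tau n)\<^sup>2 > 2 * real k * ln (inverse (sqrt (real (s n)) * (lam n)\<^sup>2)) / ln (real (p n))) \<longrightarrow>
      (\<forall>n\<ge>1. lasso_estimator (M n) (p n) (X n) (Y n) (lam n) (bhat n)) \<longrightarrow>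
      (\<exists>C1>0. \<forall>n\<ge>1.
         integrable (M n) (\<lambda>\<omega>. l1_norm (bhat n \<omega> - beta0 n) ^ k) \<and>
         root k (\<integral>\<omega>. l1_norm (bhat n \<omega> - beta0 n) ^ k \<partial>(M n)) \<le> C1 * real (s n) * lam n)"
proof -
  \<comment> \<open>128 K^4 K2 is for the noise event, 4 for 1 / n <= sqrt s lam^2.\<close>
  define c0 where "c0 = sqrt (128 * K ^ 4 * K2 + 4)"
  have c0_arg: "128 * K ^ 4 * K2 + 4 > 0" using assms by (intro add_pos_pos) auto
  then have c0: "c0 > 0" "c0\<^sup>2 = 128 * K ^ 4 * K2 + 4" by (auto simp: c0_def)
  show ?thesis
  proof (rule exI[of _ c0], intro conjI c0(1) allI impI)
    fix c :: real and M :: "nat \<Rightarrow> 'a measure" and p :: "nat \<Rightarrow> nat" and X :: "nat \<Rightarrow> 'a \<Rightarrow> real mat"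
      and eps :: "nat \<Rightarrow> 'a \<Rightarrow> real vec" and Y :: "nat \<Rightarrow> 'a \<Rightarrow> real vec" and beta0 :: "nat \<Rightarrow> real vec"
      and s :: "nat \<Rightarrow> nat" and lam :: "nat \<Rightarrow> real" and tau :: "nat \<Rightarrow> real" and bhat :: "nat \<Rightarrow> 'a \<Rightarrow> real vec"
    assume c: "c0 \<le> c"
      and model: "\<forall>n\<ge>1. sub_gaussian_linear_model (M n) n (p n) (X n) (eps n) (Y n) (beta0 n) K K2"
      and p: "\<forall>n\<ge>1. p n \<ge> 2"
      and s: "\<forall>n\<ge>1. s n = l0_norm (beta0 n) \<and> s n \<ge> 1"
      and eig_pos: "\<forall>n\<ge>1. min_eigenvalue (mean_gram (M n) (p n) (X n)) > 0"
      and eig: "(\<lambda>n. 1 / min_eigenvalue (mean_gram (M n) (p n) (X n))) \<in> O(\<lambda>_. 1)"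
      and beta: "(\<lambda>n. l2_norm (beta0 n)) \<in> O(\<lambda>_. 1)"
      and small: "(\<lambda>n. real (s n) * sqrt (ln (real (p n)) / real n)) \<in> o(\<lambda>_. 1)"
      and lam: "\<forall>n\<ge>1. lam n \<ge> c * tau n * sqrt (ln (real (p n)) / real n)"
      and tau: "\<forall>n\<ge>1. tau n > 1 \<and>
         (tau n)\<^sup>2 > 2 * real k * ln (inverse (sqrt (real (s n)) * (lam n)\<^sup>2)) / ln (real (p n))"
      and est: "\<forall>n\<ge>1. lasso_estimator (M n) (p n) (X n) (Y n) (lam n) (bhat n)"
    let ?E = "\<lambda>n. \<integral>\<omega>. l1_norm (bhat n \<omega> - beta0 n) ^ k \<partial>(M n)"
    have c_pos: "c > 0" using c c0 by linarith
    have "c0\<^sup>2 \<le> c\<^sup>2" using c c0 by (intro power_mono) auto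
    then have c2: "128 * K ^ 4 * K2 + 4 \<le> c\<^sup>2" using c0 by simp
    have lam_pos: "lam n > 0" if n: "n \<ge> 1" for n
    proof -
      have "c * tau n * sqrt (ln (real (p n)) / real n) > 0"
        using c_pos tau n half_le_ln[of "p n"] p by (intro mult_pos_pos) (auto simp: less_trans[of 0 1])
      then show ?thesis using lam n by (meson less_le_trans)
    qed
    have int: "integrable (M n) (\<lambda>\<omega>. l1_norm (bhat n \<omega> - beta0 n) ^ k)" if n: "n \<ge> 1" for n
    proof -
      interpret sub_gaussian_linear_model "M n" n "p n" "X n" "eps n" "Y n" "beta0 n" K K2
        using model n by blast
      show ?thesis using est n by (intro lasso_moment_crude(1)[OF assms(1) n lam_pos[OF n] order_refl]) auto
    qed
    obtain D where D: "D > 0"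
      "\<forall>\<^sub>F n in sequentially. norm (1 / min_eigenvalue (mean_gram (M n) (p n) (X n))) \<le> D * norm (1::real)"
      using landau_o.bigE[OF eig] by blast
    obtain A where A: "\<forall>\<^sub>F n in sequentially. norm (l2_norm (beta0 n)) \<le> A * norm (1::real)"
      using landau_o.bigE[OF beta] by blast
    define kap where "kap = 1 / D"
    have kap: "kap > 0" using D by (simp add: kap_def)
    have s_le: "s n \<ge> 1 \<and> s n \<le> p n" if n: "n \<ge> 1" for n
    proof -
      interpret sub_gaussian_linear_model "M n" n "p n" "X n" "eps n" "Y n" "beta0 n" K K2
        using model n by blast
      have "l0_norm (beta0 n) \<le> card {..<p n}"
        unfolding l0_norm_def using beta0_carrier by (intro card_mono) auto
      then show ?thesis using s[rule_format, OF n] by simp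
    qed
    define \<kappa> where "\<kappa> = (gram_precision K K2 kap)\<^sup>2 / (16 * K ^ 4 * K2)"
    have "gram_precision K K2 kap > 0" using assms kap by (simp add: gram_precision_def)
    then have \<kappa>: "\<kappa> > 0" using assms by (simp add: \<kappa>_def)
    have "\<forall>\<^sub>F n in sequentially. 2 * ln (real (p n)) + 2 * real k * ln (real n) \<le> \<kappa> * (n / (real (s n))\<^sup>2)"
      using p s_le \<kappa> by (intro eventually_sample_size small) auto
    with D(2) A eventually_ge_at_top[of 1] have "\<forall>\<^sub>F n in sequentially.
      ?E n \<le> lasso_constant K K2 k A kap * (real (s n) * lam n) ^ k"
    proof eventually_elim
      case (elim n)
      note n = elim(3)
      interpret sub_gaussian_linear_model "M n" n "p n" "X n" "eps n" "Y n" "beta0 n" K K2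
        using model n by blast
      \<comment> \<open>Positivity is what turns the bound D on the absolute reciprocal into the
        lower bound 1 / D.\<close>
      have "min_eigenvalue (mean_gram (M n) (p n) (X n)) > 0" using eig_pos n by blast
      then have "kap \<le> min_eigenvalue (mean_gram (M n) (p n) (X n))"
        using elim(1) D(1) by (simp add: kap_def field_simps)
      moreover have "l2_norm (beta0 n) \<le> A" using elim(2) by simp
      ultimately show ?case
        using n p s lam tau est elim(4)[unfolded \<kappa>_def]
        by (intro lasso_moment_bound[where c = c and tau = "tau n"] assms kap c_pos c2) auto
    qed
    then obtain N where N: "\<And>n. n \<ge> N \<Longrightarrow>
      ?E n \<le> lasso_constant K K2 k A kap * (real (s n) * lam n) ^ k"
      by (auto simp: eventually_sequentially)
    \<comment> \<open>For n < N the asymptotic assumptions give nothing, but s lam > 0 makes each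
      ratio a usable constant; absolute values let the sum dominate every member, and the final 1 in
      \<open>C1\<close> makes it positive.\<close>
    define R where "R n = \<bar>root k (?E n) / (real (s n) * lam n)\<bar>" for n
    define C1 where "C1 = root k \<bar>lasso_constant K K2 k A kap\<bar> + (\<Sum>n<N. R n) + 1"
    have k: "k > 0" using assms(3) by simp
    have R0: "(\<Sum>n<N. R n) \<ge> 0" by (intro sum_nonneg) (simp add: R_def)
    have root0: "root k \<bar>lasso_constant K K2 k A kap\<bar> \<ge> 0" by (intro real_root_ge_zero) simp
    have "root k (?E n) \<le> C1 * real (s n) * lam n" if n: "n \<ge> 1" for n
    proof -
      have sl: "real (s n) * lam n > 0" using s_le[OF n] lam_pos[OF n] by simp
      have "root k (?E n) \<le> C1 * (real (s n) * lam n)"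
      proof (cases "n < N")
        case True
        have "root k (?E n) / (real (s n) * lam n) \<le> R n" unfolding R_def by (rule abs_ge_self)
        also have "R n \<le> (\<Sum>n<N. R n)" using True by (intro member_le_sum) (auto simp: R_def)
        also have "\<dots> \<le> C1" using root0 by (simp add: C1_def)
        finally show ?thesis using sl by (simp add: pos_divide_le_eq)
      next
        case False
        have "?E n \<le> \<bar>lasso_constant K K2 k A kap\<bar> * (real (s n) * lam n) ^ k"
          using N[of n] False sl
          by (meson abs_ge_self mult_right_mono not_less order_trans zero_le_power less_imp_le)
        then have "root k (?E n) \<le> root k (\<bar>lasso_constant K K2 k A kap\<bar> * (real (s n) * lam n) ^ k)"
          using k by simp
        also have "\<dots> = root k \<bar>lasso_constant K K2 k A kap\<bar> * (real (s n) * lam n)"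
          using k sl by (simp add: real_root_mult real_root_power_cancel del: power_mult_distrib)
        also have "\<dots> \<le> C1 * (real (s n) * lam n)"
          using R0 sl by (intro mult_right_mono) (auto simp: C1_def)
        finally show ?thesis .
      qed
      then show ?thesis by (simp add: mult_ac)
    qed
    moreover have "C1 > 0" using R0 root0 by (simp add: C1_def)
    ultimately show "\<exists>C1>0. \<forall>n\<ge>1.
         integrable (M n) (\<lambda>\<omega>. l1_norm (bhat n \<omega> - beta0 n) ^ k) \<and>
         root k (?E n) \<le> C1 * real (s n) * lam n"
      using int by blast
  qed
qed

end
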